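(* Let $(\mathbf X,d)$ be a complete length space and $\Omega\subset\mathbf X$ an open set. Assume that $f:\Omega\to\mathbb R$ is locally uniformly continuous and $f>0$ in $\Omega$. Let $u\in C(\Omega)$. Then the following statements are equivalent: (a) $u$ is a local c-solution of $|\nabla u|=f$ in $\Omega$; (b) $u$ is a locally uniformly continuous s-solution of $|\nabla u|=f$ in $\Omega$; (c) $u$ is a Monge solution of $|\nabla u|=f$ in $\Omega$. In addition, if any of (a)–(c) holds, then $u$ is locally Lipschitz and $$|\nabla u|(x)=|\nabla^-u|(x)=f(x)\quad\text{for all }x\in\Omega.$$
   Context: "Local" properties (locally Lipschitz, locally uniformly continuous) are meant in a sufficiently small open ball around each point of $\Omega$; $B_r(x)$ is the open $d$-ball. A length space is a metric space where $d(x,y)$ is the infimum of lengths of rectifiable curves joining $x$ and $y$. Slopes. $\mathrm{Lip}_{loc}(\Omega)$ is the set of locally Lipschitz functions on $\Omega$. For such $u$: $|\nabla u|(x)=\limsup_{y\to x}\frac{|u(y)-u(x)|}{d(x,y)}$ and $|\nabla^\pm u|(x)=\limsup_{y\to x}\frac{[u(y)-u(x)]_\pm}{d(x,y)}$, with $[a]_+=\max\{a,0\}$, $[a]_-=-\min\{a,0\}$. Monge solutions. $u\in\mathrm{Lip}_{loc}(\Omega)$ is a Monge solution of $|\nabla u|=f$ if $|\nabla^-u|(x)=f(x)$ for every $x\in\Omega$. Admissible curves. For an interval $I\ni0$, $\mathcal A_x(I,Y)$ is the set of absolutely continuous curves $\xi:I\to Y\subset\mathbf X$ with $|\xi'|\le1$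 a.e. (i.e. $1$-Lipschitz) and $\xi(0)=x$. For open $\mathcal O$, $T^+_{\mathcal O}[\xi]=\inf\{t\in I:t\ge0,\ \xi(t)\notin\mathcal O\}$, $T^-_{\mathcal O}[\xi]=\sup\{t\in I:t\le0,\ \xi(t)\notin\mathcal O\}$ ($\inf\emptyset=+\infty$, $\sup\emptyset=-\infty$). Local c-solutions. An upper semicontinuous $u:\Omega\to\mathbb R$ is a c-subsolution of $|\nabla u|=f$ if for all $x\in\Omega$, $\xi\in\mathcal A_x(\mathbb R,\Omega)$ one has $|\phi'(0)|\le f(x)$ whenever $\phi\in C^1(\mathbb R)$ and $t\mapsto u(\xi(t))-\phi(t)$ has a local maximum at $t=0$. A lower semicontinuous $u:\Omega\to\mathbb R$ is a local c-supersolution if for each $x\in\Omega$ there is $r>0$ with $B_r(x)\subset\Omega$ such that for each $\varepsilon>0$ there are $\xi_\varepsilon\in\mathcal A_x(\mathbb R,\mathbf X)$ and a lower semicontinuous $w:(t_r^-,t_r^+)\to\mathbb R$, where $t_r^\pm=T^\pm_{B_r(x)}[\xi_\varepsilon]$, with $w(0)=u(x)$, $w(t)\ge u(\xi_\varepsilon(t))-\varepsilon$ for all $t\in(t_r^-,t_r^+)$, and $|\phi'(t_0)|\ge f(\xi_\varepsilon(t_0))-\varepsilon$ whenever $\phi\in C^1(\mathbb R)$ and $w-\phi$ attains a minimum at $t_0\in(t_r^-,t_r^+)$. A function $u\in C(\Omega)$ is a local c-solution if it is both a c-subsolution and a local c-supersolution. s-solutions. $\overline{\mathcal C}(\Omega)$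 (resp. $\underline{\mathcal C}(\Omega)$) is the set of $\psi\in\mathrm{Lip}_{loc}(\Omega)$ with $|\nabla^+\psi|=|\nabla\psi|$ (resp. $|\nabla^-\psi|=|\nabla\psi|$) and $|\nabla\psi|$ continuous in $\Omega$; $|\nabla\psi|^*(x)=\limsup_{y\to x}|\nabla\psi|(y)$. An upper semicontinuous $u$ is an s-subsolution of $|\nabla u|=f$ if $|\nabla\psi_1|(x)\le f(x)+|\nabla\psi_2|^*(x)$ whenever $\psi_1\in\underline{\mathcal C}(\Omega)$, $\psi_2\in\mathrm{Lip}_{loc}(\Omega)$ and $u-\psi_1-\psi_2$ has a local maximum at $x$. A lower semicontinuous $u$ is an s-supersolution if $|\nabla\psi_1|(x)\ge f(x)-|\nabla\psi_2|^*(x)$ whenever $\psi_1\in\overline{\mathcal C}(\Omega)$, $\psi_2\in\mathrm{Lip}_{loc}(\Omega)$ and $u-\psi_1-\psi_2$ has a local minimum at $x$. A continuous $u$ is an s-solution if it is both.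
   Formalization: In the definition of local c-supersolution, "w−φ attains a minimum at t₀" is taken as a local minimum; with a minimum over the whole interval the equivalence fails (Ω=(0,1), f=1/s+1/(1−s), u=(ln s+ln(1−s))/2). *)

theory Defs
  imports "HOL-Analysis.Analysis"
begin

text \<open>
  The ambient metric space is a whole type. Functions on an open set \<open>\<Omega>\<close> are represented by total
  functions; every notion below only looks at their values in \<open>\<Omega>\<close>.
\<close>

subsection \<open>Length spaces\<close>

definition curve_length :: "(real \<Rightarrow> 'a::metric_space) \<Rightarrow> ereal" where
  "curve_length \<gamma> =
     (SUP ts \<in> {ts. sorted ts \<and> set ts \<subseteq> {0..1}}.
        ereal (\<Sum>i<length ts - 1. dist (\<gamma> (ts ! i)) (\<gamma> (ts ! Suc i))))"

definition rectifiable :: "(real \<Rightarrow> 'a::metric_space) \<Rightarrow> bool" where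
  "rectifiable \<gamma> \<longleftrightarrow> path \<gamma> \<and> curve_length \<gamma> < \<infinity>"

text \<open>An infimum over no curves is \<open>\<infinity>\<close>, so any two points are joined by a rectifiable curve.\<close>

definition length_space :: "'a::metric_space itself \<Rightarrow> bool" where
  "length_space _ \<longleftrightarrow>
     (\<forall>x y::'a. ereal (dist x y) =
        (INF \<gamma> \<in> {\<gamma>. rectifiable \<gamma> \<and> pathstart \<gamma> = x \<and> pathfinish \<gamma> = y}. curve_length \<gamma>))"

subsection \<open>Local properties, semicontinuity, local extrema\<close>

definition locally_lipschitz_on :: "'a::metric_space set \<Rightarrow> ('a \<Rightarrow> real) \<Rightarrow> bool" where
  "locally_lipschitz_on \<Omega> u \<longleftrightarrow>
     (\<forall>x\<in>\<Omega>. \<exists>r>0. ball x r \<subseteq> \<Omega> \<and> (\<exists>L. L-lipschitz_on (ball x r) u))"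

definition locally_uniformly_continuous_on :: "'a::metric_space set \<Rightarrow> ('a \<Rightarrow> real) \<Rightarrow> bool" where
  "locally_uniformly_continuous_on \<Omega> u \<longleftrightarrow>
     (\<forall>x\<in>\<Omega>. \<exists>r>0. ball x r \<subseteq> \<Omega> \<and> uniformly_continuous_on (ball x r) u)"

definition usc_on :: "'a::topological_space set \<Rightarrow> ('a \<Rightarrow> real) \<Rightarrow> bool" where
  "usc_on S u \<longleftrightarrow> (\<forall>x\<in>S. \<forall>a>u x. \<forall>\<^sub>F y in at x within S. u y < a)"

definition lsc_on :: "'a::topological_space set \<Rightarrow> ('a \<Rightarrow> real) \<Rightarrow> bool" where
  "lsc_on S u \<longleftrightarrow> (\<forall>x\<in>S. \<forall>a<u x. \<forall>\<^sub>F y in at x within S. a < u y)"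

definition local_max_at :: "('a::topological_space \<Rightarrow> real) \<Rightarrow> 'a \<Rightarrow> bool" where
  "local_max_at g x \<longleftrightarrow> (\<forall>\<^sub>F y in nhds x. g y \<le> g x)"

definition local_min_at :: "('a::topological_space \<Rightarrow> real) \<Rightarrow> 'a \<Rightarrow> bool" where
  "local_min_at g x \<longleftrightarrow> (\<forall>\<^sub>F y in nhds x. g x \<le> g y)"

subsection \<open>Slopes\<close>

definition pos_part :: "real \<Rightarrow> real" where
  "pos_part a = max a 0"

definition neg_part :: "real \<Rightarrow> real" where
  "neg_part a = - min a 0"

text \<open>
  The outer \<open>max 0\<close> matters only at an isolated point, where \<open>Limsup\<close> is \<open>-\<infinity>\<close>: it fixes the usual
  convention that slopes vanish there.
\<close>

definition slope :: "('a::metric_space \<Rightarrow> real) \<Rightarrow> 'a \<Rightarrow> ereal" where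
  "slope u x = max 0 (Limsup (at x) (\<lambda>y. ereal (\<bar>u y - u x\<bar> / dist x y)))"

definition slope_plus :: "('a::metric_space \<Rightarrow> real) \<Rightarrow> 'a \<Rightarrow> ereal" where
  "slope_plus u x = max 0 (Limsup (at x) (\<lambda>y. ereal (pos_part (u y - u x) / dist x y)))"

definition slope_minus :: "('a::metric_space \<Rightarrow> real) \<Rightarrow> 'a \<Rightarrow> ereal" where
  "slope_minus u x = max 0 (Limsup (at x) (\<lambda>y. ereal (neg_part (u y - u x) / dist x y)))"

text \<open>The upper semicontinuous envelope of the slope: here \<open>y = x\<close> is allowed in the limsup.\<close>

definition slope_star :: "('a::metric_space \<Rightarrow> real) \<Rightarrow> 'a \<Rightarrow> ereal" where
  "slope_star u x = Limsup (nhds x) (slope u)"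

subsection \<open>Monge solutions\<close>

definition Monge_solution ::
    "'a::metric_space set \<Rightarrow> ('a \<Rightarrow> real) \<Rightarrow> ('a \<Rightarrow> real) \<Rightarrow> bool" where
  "Monge_solution \<Omega> f u \<longleftrightarrow>
     locally_lipschitz_on \<Omega> u \<and> (\<forall>x\<in>\<Omega>. slope_minus u x = ereal (f x))"

subsection \<open>Curve-based solutions\<close>

text \<open>Absolutely continuous curves of speed at most one almost everywhere are the 1-Lipschitz ones.\<close>

definition admissible_curves ::
    "'a::metric_space \<Rightarrow> real set \<Rightarrow> 'a set \<Rightarrow> (real \<Rightarrow> 'a) set" where
  "admissible_curves x I Y = {\<xi>. 1-lipschitz_on I \<xi> \<and> \<xi> ` I \<subseteq> Y \<and> \<xi> 0 = x}"

definition exit_time_plus :: "real set \<Rightarrow> 'a set \<Rightarrow> (real \<Rightarrow> 'a) \<Rightarrow> ereal" where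
  "exit_time_plus I U \<xi> = Inf (ereal ` {t \<in> I. t \<ge> 0 \<and> \<xi> t \<notin> U})"

definition exit_time_minus :: "real set \<Rightarrow> 'a set \<Rightarrow> (real \<Rightarrow> 'a) \<Rightarrow> ereal" where
  "exit_time_minus I U \<xi> = Sup (ereal ` {t \<in> I. t \<le> 0 \<and> \<xi> t \<notin> U})"

definition c_subsolution ::
    "'a::metric_space set \<Rightarrow> ('a \<Rightarrow> real) \<Rightarrow> ('a \<Rightarrow> real) \<Rightarrow> bool" where
  "c_subsolution \<Omega> f u \<longleftrightarrow> usc_on \<Omega> u \<and>
     (\<forall>x\<in>\<Omega>. \<forall>\<xi>\<in>admissible_curves x UNIV \<Omega>. \<forall>\<phi>::real \<Rightarrow> real.
        \<phi> C1_differentiable_on UNIV \<longrightarrow> local_max_at (\<lambda>t. u (\<xi> t) - \<phi> t) 0 \<longrightarrow>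
        \<bar>deriv \<phi> 0\<bar> \<le> f x)"

text \<open>
  The minimum of \<open>w - \<phi>\<close> in the supersolution test is read as a local minimum, as usual for
  viscosity solutions. A minimum over the whole interval would be too weak a test: if \<open>u\<close> tends to
  \<open>-\<infinity>\<close> at the boundary of \<open>ball x r\<close>, as \<open>u s = (ln s + ln (1 - s)) / 2\<close> does on \<open>{0<..<1}\<close>, then for
  \<open>w = u \<circ> \<xi>\<close> with \<open>\<xi>\<close> running into that boundary no \<open>\<phi>\<close> would be tested at all.
\<close>

definition local_c_supersolution ::
    "'a::metric_space set \<Rightarrow> ('a \<Rightarrow> real) \<Rightarrow> ('a \<Rightarrow> real) \<Rightarrow> bool" where
  "local_c_supersolution \<Omega> f u \<longleftrightarrow> lsc_on \<Omega> u \<and>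
     (\<forall>x\<in>\<Omega>. \<exists>r>0. ball x r \<subseteq> \<Omega> \<and>
        (\<forall>\<epsilon>>0. \<exists>\<xi>\<in>admissible_curves x UNIV UNIV. \<exists>w::real \<Rightarrow> real.
           let J = {t. exit_time_minus UNIV (ball x r) \<xi> < ereal t \<and>
                       ereal t < exit_time_plus UNIV (ball x r) \<xi>}
           in lsc_on J w \<and> w 0 = u x \<and>
              (\<forall>t\<in>J. w t \<ge> u (\<xi> t) - \<epsilon>) \<and>
              (\<forall>\<phi>::real \<Rightarrow> real. \<forall>t0\<in>J.
                 \<phi> C1_differentiable_on UNIV \<longrightarrow> local_min_at (\<lambda>t. w t - \<phi> t) t0 \<longrightarrow>
                 \<bar>deriv \<phi> t0\<bar> \<ge> f (\<xi> t0) - \<epsilon>)))"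

definition local_c_solution ::
    "'a::metric_space set \<Rightarrow> ('a \<Rightarrow> real) \<Rightarrow> ('a \<Rightarrow> real) \<Rightarrow> bool" where
  "local_c_solution \<Omega> f u \<longleftrightarrow>
     continuous_on \<Omega> u \<and> c_subsolution \<Omega> f u \<and> local_c_supersolution \<Omega> f u"

subsection \<open>Slope-based solutions\<close>

definition C_upper :: "'a::metric_space set \<Rightarrow> ('a \<Rightarrow> real) set" where
  "C_upper \<Omega> = {\<psi>. locally_lipschitz_on \<Omega> \<psi> \<and>
     (\<forall>x\<in>\<Omega>. slope_plus \<psi> x = slope \<psi> x) \<and> continuous_on \<Omega> (slope \<psi>)}"

definition C_lower :: "'a::metric_space set \<Rightarrow> ('a \<Rightarrow> real) set" where
  "C_lower \<Omega> = {\<psi>. locally_lipschitz_on \<Omega> \<psi> \<and>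
     (\<forall>x\<in>\<Omega>. slope_minus \<psi> x = slope \<psi> x) \<and> continuous_on \<Omega> (slope \<psi>)}"

definition s_subsolution ::
    "'a::metric_space set \<Rightarrow> ('a \<Rightarrow> real) \<Rightarrow> ('a \<Rightarrow> real) \<Rightarrow> bool" where
  "s_subsolution \<Omega> f u \<longleftrightarrow> usc_on \<Omega> u \<and>
     (\<forall>\<psi>1 \<psi>2. \<forall>x\<in>\<Omega>. \<psi>1 \<in> C_lower \<Omega> \<longrightarrow> locally_lipschitz_on \<Omega> \<psi>2 \<longrightarrow>
        local_max_at (\<lambda>y. u y - \<psi>1 y - \<psi>2 y) x \<longrightarrow>
        slope \<psi>1 x \<le> ereal (f x) + slope_star \<psi>2 x)"

definition s_supersolution ::
    "'a::metric_space set \<Rightarrow> ('a \<Rightarrow> real) \<Rightarrow> ('a \<Rightarrow> real) \<Rightarrow> bool" where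
  "s_supersolution \<Omega> f u \<longleftrightarrow> lsc_on \<Omega> u \<and>
     (\<forall>\<psi>1 \<psi>2. \<forall>x\<in>\<Omega>. \<psi>1 \<in> C_upper \<Omega> \<longrightarrow> locally_lipschitz_on \<Omega> \<psi>2 \<longrightarrow>
        local_min_at (\<lambda>y. u y - \<psi>1 y - \<psi>2 y) x \<longrightarrow>
        slope \<psi>1 x \<ge> ereal (f x) - slope_star \<psi>2 x)"

definition s_solution ::
    "'a::metric_space set \<Rightarrow> ('a \<Rightarrow> real) \<Rightarrow> ('a \<Rightarrow> real) \<Rightarrow> bool" where
  "s_solution \<Omega> f u \<longleftrightarrow> continuous_on \<Omega> u \<and> s_subsolution \<Omega> f u \<and> s_supersolution \<Omega> f u"

end

theory Submission
  imports Defs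
begin

text \<open>
  All three notions amount to the same pair of conditions on \<open>u\<close>: near each \<open>x\<close> the function is
  Lipschitz with every constant above \<open>f x\<close>, and \<open>f x \<le> |\<nabla>\<^sup>-u|(x)\<close>. The first says \<open>|\<nabla>u| \<le> f\<close>, so
  together they give \<open>f \<le> |\<nabla>\<^sup>-u| \<le> |\<nabla>u| \<le> f\<close>.

  A c-subsolution is Lipschitz along almost-geodesics by a one-dimensional viscosity argument, and an
  s-subsolution is Lipschitz by comparison with smoothed cones \<open>k d(x,\<cdot>)\<close>, where Ekeland's principle
  stands in for compactness. A Monge solution is trivially an s-subsolution, so it inherits this
  bound. Dually, comparison from below shows that supersolutions of either kind decrease from \<open>x\<close> at
  rate \<open>f x\<close>. Conversely, the pointwise slope conditions pass to test functions directly; only the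
  curves of a c-supersolution need a construction, by repeated almost-steepest descent, each step of
  which is again an application of Ekeland's principle.
\<close>


subsection \<open>Ekeland's principle\<close>

text \<open>The obstacle throughout is that balls need not be compact and points need not be joined
  by a shortest curve, so extrema and steepest-descent points need not exist. Every estimate is
  therefore run with a strict margin: constants are interpolated between the two sides of the claim,
  and the margin pays for the perturbation \<open>\<delta>\<close>, for the excess length of an
  almost-geodesic and for the rounding of a cone. One-sided information such as a bound on
  \<open>slope_minus\<close> yields a two-sided Lipschitz bound because the comparison is uniform in
  its centre: the two points may be interchanged. The length space makes radial functions usable as
  tests. Moving towards x along an almost-geodesic lowers \<open>dist x\<close> at nearly unit rate,
  so increasing radial profiles with derivative 0 at the apex lie in \<open>C_lower\<close>, and
  their negatives in \<open>C_upper\<close>. Local uniform continuity of f gives all nodes of a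
  descent curve one common step length.\<close>

lemma ekeland:
  fixes F :: "'a::complete_space \<Rightarrow> real"
  assumes S: "closed S" "continuous_on S F" and b: "\<And>y. y \<in> S \<Longrightarrow> b \<le> F y"
    and x: "x \<in> S" and \<delta>: "0 < \<delta>"
  obtains z where "z \<in> S" "F z + \<delta> * dist x z \<le> F x" "\<And>v. v \<in> S \<Longrightarrow> F z \<le> F v + \<delta> * dist z v"
proof -
  \<comment> \<open>\<open>T z\<close> holds the points reached from z by a drop of at least
    \<open>\<delta>\<close> per unit of distance. This is a partial order on S, and the point sought
    is one from which no further drop is possible.\<close>
  define T where "T z = {v\<in>S. F v + \<delta> * dist z v \<le> F z}" for z
  have T_refl: "z \<in> T z" if "z \<in> S" for z
    using that by (simp add: T_def)
  have T_trans: "w \<in> T z" if "v \<in> T z" "w \<in> T v" for z v w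
  proof -
    have "\<delta> * dist z w \<le> \<delta> * dist z v + \<delta> * dist v w"
      using \<delta> dist_triangle[of z w v] by (metis distrib_left less_eq_real_def mult_left_mono)
    with that show ?thesis by (auto simp: T_def)
  qed
  have step: "\<exists>w. w \<in> T z \<and> (\<forall>v\<in>T z. F w \<le> F v + inverse (Suc n))" if "z \<in> S" for z and n :: nat
  proof -
    have bdd: "bdd_below (F ` T z)"
      by (rule bdd_belowI[where m=b]) (auto simp: T_def b)
    have ne: "F ` T z \<noteq> {}" using T_refl[OF that] by auto
    have "Inf (F ` T z) < Inf (F ` T z) + inverse (Suc n)" by simp
    then obtain w where "w \<in> T z" "F w < Inf (F ` T z) + inverse (Suc n)"
      using cInf_lessD[OF ne] by (metis imageE)
    moreover have "Inf (F ` T z) \<le> F v" if "v \<in> T z" for v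
      using that bdd by (simp add: cInf_lower)
    ultimately show ?thesis by force
  qed
  \<comment> \<open>Each step nearly minimizes F over the current set, with error tending to 0; the
    sets \<open>T (p n)\<close> are nested.\<close>
  obtain p where p: "p 0 = x" "\<And>n::nat. p n \<in> S"
    "\<And>n. p (Suc n) \<in> T (p n) \<and> (\<forall>v\<in>T (p n). F (p (Suc n)) \<le> F v + inverse (Suc n))"
  proof -
    have "\<exists>p. \<forall>n. (p n \<in> S \<and> (n = 0 \<longrightarrow> p n = x)) \<and>
       (p (Suc n) \<in> T (p n) \<and> (\<forall>v\<in>T (p n). F (p (Suc n)) \<le> F v + inverse (Suc n)))"
    proof (rule dependent_nat_choice)
      show "\<exists>z. z \<in> S \<and> (0 = 0 \<longrightarrow> z = x)" using x by auto
    next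
      fix z and n :: nat assume "z \<in> S \<and> (n = 0 \<longrightarrow> z = x)"
      then show "\<exists>w. (w \<in> S \<and> (Suc n = 0 \<longrightarrow> w = x)) \<and> w \<in> T z \<and>
        (\<forall>v\<in>T z. F w \<le> F v + inverse (Suc n))"
        using step[of z n] by (auto simp: T_def)
    qed
    then show ?thesis using that by blast
  qed
  have pT: "p m \<in> T (p n)" if "n \<le> m" for n m
    using that by (induction rule: dec_induct) (use p T_refl T_trans in blast)+
  have dec: "decseq (\<lambda>n. F (p n))"
    unfolding decseq_def
  proof (intro allI impI)
    fix m n :: nat assume "m \<le> n"
    then have "F (p n) + \<delta> * dist (p m) (p n) \<le> F (p m)" using pT by (simp add: T_def)
    moreover have "0 \<le> \<delta> * dist (p m) (p n)" using \<delta> by simp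
    ultimately show "F (p n) \<le> F (p m)" by linarith
  qed
  obtain l where l: "(\<lambda>n. F (p n)) \<longlonglongrightarrow> l" "\<And>n. l \<le> F (p n)"
    using decseq_convergent[OF dec, of b] b p(2) by metis
  \<comment> \<open>The distances are bounded by the decrease of F divided by
    \<open>\<delta>\<close>, and F converges along the sequence.\<close>
  have "Cauchy p"
    unfolding Cauchy_altdef2
  proof (intro allI impI)
    fix e :: real assume "e > 0"
    with \<delta> have "l < l + \<delta> * e" by simp
    then obtain N where N: "F (p N) < l + \<delta> * e"
      using order_tendstoD(2)[OF l(1)] by (metis (mono_tags, lifting) eventually_sequentially order_refl)
    have "dist (p n) (p N) < e" if "n \<ge> N" for n
    proof -
      have "\<delta> * dist (p N) (p n) \<le> F (p N) - F (p n)" using pT[OF that] by (simp add: T_def)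
      also have "\<dots> < \<delta> * e" using N l(2)[of n] by linarith
      finally show ?thesis using \<delta> by (simp add: dist_commute)
    qed
    then show "\<exists>N. \<forall>n\<ge>N. dist (p n) (p N) < e" by blast
  qed
  then obtain z where z: "p \<longlonglongrightarrow> z" using Cauchy_convergent convergent_def by blast
  have zS: "z \<in> S" using closed_sequentially[OF S(1)] p(2) z by blast
  have Fz: "(\<lambda>n. F (p n)) \<longlonglongrightarrow> F z"
    using S(2) zS z p(2) by (auto simp: continuous_on_sequentially o_def)
  have zT: "z \<in> T (p n)" for n
  proof -
    have lim: "(\<lambda>m. F (p m) + \<delta> * dist (p n) (p m)) \<longlonglongrightarrow> F z + \<delta> * dist (p n) z"
      by (intro tendsto_intros Fz z)
    have "F z + \<delta> * dist (p n) z \<le> F (p n)"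
      by (rule LIMSEQ_le_const2[OF lim]) (use pT in \<open>auto simp: T_def\<close>)
    then show ?thesis using zS by (simp add: T_def)
  qed
  show ?thesis
  proof
    show "z \<in> S" "F z + \<delta> * dist x z \<le> F x" using zT[of 0] p(1) by (auto simp: T_def)
    fix v assume v: "v \<in> S"
    show "F z \<le> F v + \<delta> * dist z v"
    proof (rule ccontr)
      assume c: "\<not> F z \<le> F v + \<delta> * dist z v"
      \<comment> \<open>Since z lies below every \<open>p n\<close>, so does v; near-minimality then
        forces \<open>F z \<le> F v\<close> in the limit, against the strict drop from z to
        v.\<close>
      then have "v \<in> T z" using v by (simp add: T_def)
      then have "F (p (Suc n)) \<le> F v + inverse (Suc n)" for n
        using p(3) zT T_trans by blast
      moreover have "(\<lambda>n. F v + inverse (Suc n)) \<longlonglongrightarrow> F v + 0"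
        by (intro tendsto_intros LIMSEQ_inverse_real_of_nat)
      ultimately have "F z \<le> F v"
        using LIMSEQ_le[OF LIMSEQ_Suc[OF Fz], of "\<lambda>n. F v + inverse (Suc n)" "F v"] by force
      moreover have "0 \<le> \<delta> * dist z v" using \<delta> by simp
      ultimately show False using c by linarith
    qed
  qed
qed

subsection \<open>Almost-geodesics parametrized with speed at most one\<close>

lemma sum_dist_append:
  fixes \<gamma> :: "real \<Rightarrow> 'a::metric_space"
  shows "(\<Sum>i<length ts - 1. dist (\<gamma> (ts ! i)) (\<gamma> (ts ! Suc i))) + dist (\<gamma> a) (\<gamma> b)
    \<le> (\<Sum>i<length (ts @ [a, b]) - 1. dist (\<gamma> ((ts @ [a, b]) ! i)) (\<gamma> ((ts @ [a, b]) ! Suc i)))"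
proof -
  let ?g = "\<lambda>ts i. dist (\<gamma> (ts ! i)) (\<gamma> (ts ! Suc i))"
  have "sum (?g ts) {..<length ts - 1} = sum (?g (ts @ [a, b])) {..<length ts - 1}"
    by (intro sum.cong) (auto simp: nth_append)
  also have "\<dots> \<le> sum (?g (ts @ [a, b])) {..<length ts}"
    by (intro sum_mono2) auto
  finally have "sum (?g ts) {..<length ts - 1} \<le> sum (?g (ts @ [a, b])) {..<length ts}" .
  moreover have "?g (ts @ [a, b]) (length ts) = dist (\<gamma> a) (\<gamma> b)"
    by (simp add: nth_append)
  ultimately show ?thesis by simp
qed

lemma arc_length_function:
  fixes \<gamma> :: "real \<Rightarrow> 'a::metric_space"
  assumes "curve_length \<gamma> < ereal L"
  obtains l where "\<And>s t. 0 \<le> s \<Longrightarrow> s \<le> t \<Longrightarrow> t \<le> 1 \<Longrightarrow> dist (\<gamma> s) (\<gamma> t) \<le> l t - l s" "0 \<le> l 0" "l 1 \<le> L"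
proof -
  define V where "V ts = (\<Sum>i<length ts - 1. dist (\<gamma> (ts ! i)) (\<gamma> (ts ! Suc i)))" for ts
  \<comment> \<open>\<open>Sup (A t)\<close> is the variation of the curve on \<open>{0..t}\<close>.
    A partition of \<open>{0..s}\<close> may stop before s, so both s and t are appended to
    it.\<close>
  define A where "A t = V ` {ts. sorted ts \<and> set ts \<subseteq> {0..t}}" for t :: real
  have VL: "v \<le> L" if "v \<in> A t" "t \<le> 1" for v t
  proof -
    obtain ts where "sorted ts" "set ts \<subseteq> {0..t}" and v: "v = V ts"
      using \<open>v \<in> A t\<close> by (auto simp: A_def)
    then have "sorted ts" "set ts \<subseteq> {0..1}" using \<open>t \<le> 1\<close> by auto
    then have "ereal (V ts) \<le> curve_length \<gamma>"
      unfolding curve_length_def V_def by (intro SUP_upper) auto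
    from le_less_trans[OF this assms] have "ereal (V ts) < ereal L" .
    then show ?thesis using v by simp
  qed
  have bdd: "bdd_above (A t)" if "t \<le> 1" for t using VL that by (meson bdd_aboveI)
  have "V [] \<in> A t" for t unfolding A_def by (rule imageI) auto
  then have ne: "A t \<noteq> {}" and zero: "0 \<in> A t" for t by (auto simp: V_def)
  show ?thesis
  proof
    fix s t :: real assume st: "0 \<le> s" "s \<le> t" "t \<le> 1"
    have "v \<le> Sup (A t) - dist (\<gamma> s) (\<gamma> t)" if "v \<in> A s" for v
    proof -
      obtain ts where ts: "sorted ts" "set ts \<subseteq> {0..s}" and v: "v = V ts"
        using \<open>v \<in> A s\<close> by (auto simp: A_def)
      have "V (ts @ [s, t]) \<in> A t"
        unfolding A_def using ts st by (intro imageI) (fastforce simp: sorted_append)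
      then have "V (ts @ [s, t]) \<le> Sup (A t)" using bdd st by (intro cSup_upper)
      then show ?thesis using sum_dist_append[of \<gamma> ts s t] v unfolding V_def by linarith
    qed
    then have "Sup (A s) \<le> Sup (A t) - dist (\<gamma> s) (\<gamma> t)" by (intro cSup_least ne)
    then show "dist (\<gamma> s) (\<gamma> t) \<le> Sup (A t) - Sup (A s)" by simp
  next
    show "0 \<le> Sup (A 0)" using zero bdd by (simp add: cSup_upper)
    show "Sup (A 1) \<le> L" using VL ne by (intro cSup_least) auto
  qed
qed

text \<open>A connecting curve shorter than L is run by arc length, so it arrives by time L and then
  waits at y. The resting pieces make it a curve on the whole line.\<close>

lemma length_space_curve:
  fixes x y :: "'a::metric_space"
  assumes ls: "length_space TYPE('a)" and L: "dist x y < L"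
  obtains \<xi> where "1-lipschitz_on UNIV \<xi>" "\<And>t. t \<le> 0 \<Longrightarrow> \<xi> t = x" "\<And>t. L \<le> t \<Longrightarrow> \<xi> t = y"
proof -
  have "(INF \<gamma> \<in> {\<gamma>. rectifiable \<gamma> \<and> pathstart \<gamma> = x \<and> pathfinish \<gamma> = y}. curve_length \<gamma>) < ereal L"
    using ls L unfolding length_space_def by (metis ereal_less_eq(3) less_ereal.simps(1))
  then obtain \<gamma> where \<gamma>: "path \<gamma>" "\<gamma> 0 = x" "\<gamma> 1 = y" "curve_length \<gamma> < ereal L"
    by (auto simp: INF_less_iff rectifiable_def pathstart_def pathfinish_def)
  obtain l where l: "\<And>s t. 0 \<le> s \<Longrightarrow> s \<le> t \<Longrightarrow> t \<le> 1 \<Longrightarrow> dist (\<gamma> s) (\<gamma> t) \<le> l t - l s"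
    and l0: "0 \<le> l 0" and l1: "l 1 \<le> L"
    using arc_length_function[OF \<gamma>(4)] by blast
  \<comment> \<open>\<open>\<tau>\<close> is a generalized inverse of the arc length \<open>l\<close>; continuity of \<open>l\<close> is not needed for
    \<open>\<gamma> \<circ> \<tau>\<close> to be 1-Lipschitz.\<close>
  define E where "E s = insert 0 {t\<in>{0..1}. l t \<le> s}" for s
  define \<tau> where "\<tau> s = Sup (E s)" for s
  have bdd: "bdd_above (E s)" for s by (rule bdd_aboveI[where M=1]) (auto simp: E_def)
  have \<tau>01: "\<tau> s \<in> {0..1}" for s
    unfolding \<tau>_def using bdd[of s]
    by (auto intro!: cSup_least cSup_upper simp: E_def)
  have cont: "continuous_on {0..1} \<gamma>" using \<gamma>(1) by (simp add: path_def)
  have near: "\<exists>t\<in>E s. t \<le> \<tau> s \<and> \<tau> s - t < e" if "e > 0" for s e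
    using less_cSupD[of "E s" "\<tau> s - e"] that cSup_upper[OF _ bdd[of s]]
    by (force simp: \<tau>_def E_def)
  have cont': "\<exists>d>0. \<forall>t\<in>{0..1}. \<bar>t - a\<bar> < d \<longrightarrow> dist (\<gamma> t) (\<gamma> a) < e" if "a \<in> {0..1}" "e > 0" for a e
    using cont that unfolding continuous_on_iff dist_real_def by blast
  have key: "dist (\<gamma> (\<tau> s)) (\<gamma> (\<tau> s')) \<le> s' - s" if "0 \<le> s" "s \<le> s'" for s s'
  proof (cases "\<tau> s < \<tau> s'")
    case False
    have "\<tau> s \<le> \<tau> s'" unfolding \<tau>_def
      by (intro cSup_subset_mono bdd) (use that in \<open>auto simp: E_def\<close>)
    with False show ?thesis using that by simp
  next
    case True
    show ?thesis
    proof (rule field_le_epsilon)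
      fix e :: real assume e: "e > 0"
      obtain d1 where d1: "d1 > 0" "\<And>t. t \<in> {0..1} \<Longrightarrow> \<bar>t - \<tau> s\<bar> < d1 \<Longrightarrow> dist (\<gamma> t) (\<gamma> (\<tau> s)) < e/2"
        using cont'[OF \<tau>01[of s], of "e/2"] e by auto
      obtain d2 where d2: "d2 > 0" "\<And>t. t \<in> {0..1} \<Longrightarrow> \<bar>t - \<tau> s'\<bar> < d2 \<Longrightarrow> dist (\<gamma> t) (\<gamma> (\<tau> s')) < e/2"
        using cont'[OF \<tau>01[of s'], of "e/2"] e by auto
      \<comment> \<open>Since \<open>l\<close> may jump, its values at \<open>\<tau> s\<close> and
        \<open>\<tau> s'\<close> are avoided. A point a just right of \<open>\<tau> s\<close> is
        outside \<open>E s\<close>, so \<open>s < l a\<close>; a point t of \<open>E s'\<close>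
        close to \<open>\<tau> s'\<close> has \<open>l t \<le> s'\<close>, where
        \<open>a < t\<close> rules out the inserted 0. Continuity of \<open>\<gamma>\<close> closes
        both gaps.\<close>
      define a where "a = \<tau> s + min (d1/2) ((\<tau> s' - \<tau> s)/2)"
      have a: "\<tau> s < a" "a < \<tau> s'" "a - \<tau> s < d1" using True d1(1) by (auto simp: a_def min_def field_simps)
      obtain t where t: "t \<in> E s'" "t \<le> \<tau> s'" "\<tau> s' - t < min d2 (\<tau> s' - a)"
        using near[of "min d2 (\<tau> s' - a)" s'] a d2(1) by auto
      have a01: "a \<in> {0..1}" and t01: "t \<in> {0..1}"
        using \<tau>01[of s] \<tau>01[of s'] a t(1) by (auto simp: E_def)
      have "a \<notin> E s" using a(1) cSup_upper[OF _ bdd[of s], of a] by (auto simp: \<tau>_def)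
      then have "s < l a" using a01 by (auto simp: E_def)
      moreover have "l t \<le> s'" using t a \<tau>01[of s] by (auto simp: E_def)
      moreover have "dist (\<gamma> a) (\<gamma> t) \<le> l t - l a" using l t a01 t01 by auto
      moreover have "dist (\<gamma> a) (\<gamma> (\<tau> s)) < e/2" using d1(2) a01 a by auto
      moreover have "dist (\<gamma> t) (\<gamma> (\<tau> s')) < e/2" using d2(2) t01 t by auto
      ultimately show "dist (\<gamma> (\<tau> s)) (\<gamma> (\<tau> s')) \<le> s' - s + e"
        by metric
    qed
  qed
  have neg: "\<gamma> (\<tau> 0) = x"
  proof (rule ccontr)
    assume c: "\<gamma> (\<tau> 0) \<noteq> x"
    obtain d where d: "d > 0" "\<And>t. t \<in> {0..1} \<Longrightarrow> \<bar>t - \<tau> 0\<bar> < d \<Longrightarrow> dist (\<gamma> t) (\<gamma> (\<tau> 0)) < dist (\<gamma> (\<tau> 0)) x"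
      using cont'[OF \<tau>01[of 0], of "dist (\<gamma> (\<tau> 0)) x"] c by auto
    obtain t where t: "t \<in> E 0" "t \<le> \<tau> 0" "\<tau> 0 - t < d" using near[OF d(1)] by auto
    have "\<gamma> t = x"
    proof (cases "t = 0")
      case False
      then have "0 \<le> t" "t \<le> 1" "l t \<le> 0" using t(1) by (auto simp: E_def)
      then have "dist (\<gamma> 0) (\<gamma> t) \<le> 0" using l[of 0 t] l0 by linarith
      then show ?thesis using \<gamma> by simp
    qed (use \<gamma> in simp)
    then show False using d(2)[of t] t by (auto simp: E_def dist_commute)
  qed
  have last: "\<gamma> (\<tau> L) = y"
  proof -
    have "1 \<in> E L" using l1 by (simp add: E_def)
    then have "1 \<le> \<tau> L" unfolding \<tau>_def by (intro cSup_upper bdd)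
    then have "\<tau> L = 1" using \<tau>01[of L] by auto
    then show ?thesis using \<gamma> by simp
  qed
  have L0: "0 < L" using L le_less_trans[OF zero_le_dist L] by simp
  define c where "c t = max 0 (min L t)" for t
  show ?thesis
  proof
    show "1-lipschitz_on UNIV (\<lambda>t. \<gamma> (\<tau> (c t)))"
    proof (rule lipschitz_onI)
      fix t t' :: real
      have *: "dist (\<gamma> (\<tau> (c t))) (\<gamma> (\<tau> (c t'))) \<le> 1 * dist t t'" if "t \<le> t'" for t t'
      proof -
        have "0 \<le> c t" "c t \<le> c t'" "c t' - c t \<le> t' - t" using that L0 by (auto simp: c_def)
        then show ?thesis using key[of "c t" "c t'"] that by (simp add: dist_real_def)
      qed
      show "dist (\<gamma> (\<tau> (c t))) (\<gamma> (\<tau> (c t'))) \<le> 1 * dist t t'"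
        using *[of t t'] *[of t' t] by (cases "t \<le> t'") (auto simp: dist_commute)
    qed simp
    show "\<gamma> (\<tau> (c t)) = x" if "t \<le> 0" for t using that neg L0 by (simp add: c_def)
    show "\<gamma> (\<tau> (c t)) = y" if "L \<le> t" for t using that last L0 by (simp add: c_def)
  qed
qed


subsection \<open>Slopes\<close>

text \<open>Turns all slope bounds into inequalities without division. A limsup bound controls only
  constants strictly above c, and \<open>max 0\<close> is harmless for nonnegative c.\<close>

lemma limsup_quotient_le_iff:
  fixes x :: "'a::metric_space"
  assumes c: "0 \<le> c"
  shows "max 0 (Limsup (at x) (\<lambda>y. ereal (g y / dist x y))) \<le> ereal c \<longleftrightarrow>
    (\<forall>k>c. \<forall>\<^sub>F y in at x. g y \<le> k * dist x y)" (is "?l \<longleftrightarrow> ?r")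
proof -
  have "?l \<longleftrightarrow> (\<forall>a>ereal c. \<forall>\<^sub>F y in at x. ereal (g y / dist x y) < a)"
    using c by (simp add: Limsup_le_iff)
  also have "\<dots> \<longleftrightarrow> ?r"
  proof (intro iffI allI impI)
    fix k assume "\<forall>a>ereal c. \<forall>\<^sub>F y in at x. ereal (g y / dist x y) < a" "c < k"
    then have "\<forall>\<^sub>F y in at x. ereal (g y / dist x y) < ereal k"
      using ereal_less_eq(3) less_ereal.simps(1) by blast
    then show "\<forall>\<^sub>F y in at x. g y \<le> k * dist x y"
      unfolding eventually_at_filter by eventually_elim (auto simp: divide_less_eq)
  next
    fix a assume r: ?r and a: "ereal c < a"
    obtain k where k: "ereal c < ereal k" "ereal k < a" using ereal_dense2[OF a] by blast
    then have "\<forall>\<^sub>F y in at x. g y \<le> k * dist x y" using r by simp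
    then have "\<forall>\<^sub>F y in at x. g y / dist x y \<le> k"
      unfolding eventually_at_filter by eventually_elim (auto simp: divide_le_eq)
    then show "\<forall>\<^sub>F y in at x. ereal (g y / dist x y) < a"
      by eventually_elim (use k(2) ereal_less_eq(3) le_less_trans in blast)
  qed
  finally show ?thesis .
qed

lemma neg_part_le_iff: "0 \<le> k \<Longrightarrow> neg_part a \<le> k \<longleftrightarrow> - a \<le> k"
  by (auto simp: neg_part_def)

lemma slope_le_iff:
  "0 \<le> c \<Longrightarrow> slope u x \<le> ereal c \<longleftrightarrow> (\<forall>k>c. \<forall>\<^sub>F y in at x. \<bar>u y - u x\<bar> \<le> k * dist x y)"
  unfolding slope_def by (rule limsup_quotient_le_iff)

lemma slope_minus_le_iff:
  assumes "0 \<le> c"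
  shows "slope_minus u x \<le> ereal c \<longleftrightarrow> (\<forall>k>c. \<forall>\<^sub>F y in at x. u x - u y \<le> k * dist x y)"
  unfolding slope_minus_def limsup_quotient_le_iff[OF assms]
  using assms by (simp add: neg_part_le_iff)

lemma slope_minus_leI:
  assumes "0 \<le> c" "\<forall>\<^sub>F y in at x. u x - u y \<le> c * dist x y"
  shows "slope_minus u x \<le> ereal c"
  unfolding slope_minus_le_iff[OF assms(1)]
proof (intro allI impI)
  fix k assume "c < k"
  show "\<forall>\<^sub>F y in at x. u x - u y \<le> k * dist x y"
    using assms(2)
  proof eventually_elim
    case (elim y)
    have "c * dist x y \<le> k * dist x y" using \<open>c < k\<close> by (intro mult_right_mono) auto
    with elim show ?case by linarith
  qed
qed

lemma slope_nonneg: "0 \<le> slope u x" "0 \<le> slope_minus u x"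
  by (simp_all add: slope_def slope_minus_def)

text \<open>The strict inequality in the hypothesis already excludes \<open>y = x\<close>.
  Nonnegative k suffice because \<open>slope_minus\<close> is nonnegative.\<close>

lemma slope_minus_geI:
  assumes "\<And>k e. 0 \<le> k \<Longrightarrow> k < c \<Longrightarrow> 0 < e \<Longrightarrow> \<exists>y. dist x y < e \<and> k * dist x y < u x - u y"
  shows "ereal c \<le> slope_minus u x"
proof (rule ccontr)
  assume "\<not> ?thesis"
  then obtain k where k: "slope_minus u x < ereal k" "ereal k < ereal c"
    using ereal_dense2 by (meson not_le)
  have k0: "0 \<le> k" using le_less_trans[OF slope_nonneg(2) k(1)] by simp
  define k' where "k' = (k + c) / 2"
  have k': "k < k'" "k' < c" using k(2) by (auto simp: k'_def)
  have "\<forall>\<^sub>F y in at x. u x - u y \<le> k' * dist x y"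
    using slope_minus_le_iff[OF k0, of u x] k(1) k'(1) by (simp add: less_imp_le)
  then obtain e where e: "e > 0" "\<And>y. y \<noteq> x \<Longrightarrow> dist x y < e \<Longrightarrow> u x - u y \<le> k' * dist x y"
    by (auto simp: eventually_at dist_commute)
  then obtain y where "dist x y < e" "k' * dist x y < u x - u y"
    using assms[of k' e] k' k0 by auto
  then show False using e(2)[of y] by (cases "y = x") auto
qed

lemma slope_minus_le_slope: "slope_minus u x \<le> slope u x"
proof -
  have "neg_part a / d \<le> \<bar>a\<bar> / d" if "0 \<le> d" for a d :: real
    using that by (intro divide_right_mono) (auto simp: neg_part_def)
  then show ?thesis unfolding slope_minus_def slope_def
    by (intro max.mono Limsup_mono always_eventually order_refl allI) simp
qed

lemma slope_uminus: "slope (\<lambda>y. - u y) x = slope u x"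
  by (simp add: slope_def abs_minus_commute)

lemma slope_plus_uminus: "slope_plus (\<lambda>y. - u y) x = slope_minus u x"
proof -
  have "pos_part (- u y + u x) = neg_part (u y - u x)" for y
    by (auto simp: pos_part_def neg_part_def)
  then show ?thesis by (simp add: slope_plus_def slope_minus_def)
qed

lemma slope_le_lipschitz:
  assumes "L-lipschitz_on (ball x r) u" "r > 0"
  shows "slope u x \<le> ereal L"
  unfolding slope_le_iff[OF lipschitz_on_nonneg[OF assms(1)]]
proof (intro allI impI)
  fix k assume k: "L < k"
  have "\<forall>\<^sub>F y in at x. y \<in> ball x r" using assms(2)
    by (intro eventually_at_in_open') auto
  then show "\<forall>\<^sub>F y in at x. \<bar>u y - u x\<bar> \<le> k * dist x y"
  proof eventually_elim
    case (elim y)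
    have "\<bar>u y - u x\<bar> \<le> L * dist x y"
      using lipschitz_onD[OF assms(1), of y x] elim assms(2) by (auto simp: dist_real_def dist_commute)
    also have "\<dots> \<le> k * dist x y" using k by (intro mult_right_mono) auto
    finally show ?case .
  qed
qed

lemma slope_le_slope_star: "slope u x \<le> slope_star u x"
  unfolding slope_star_def Limsup_def
proof (rule INF_greatest)
  fix P assume "P \<in> {P. eventually P (nhds x)}"
  then have "P x" by (simp add: eventually_nhds_x_imp_x)
  then show "slope u x \<le> Sup (slope u ` Collect P)" by (auto intro: SUP_upper)
qed

lemma slope_star_le_lipschitz:
  assumes "L-lipschitz_on UNIV u"
  shows "slope_star u x \<le> ereal L"
  unfolding slope_star_def
  by (intro Limsup_bounded always_eventually allI slope_le_lipschitz[where r=1]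
      lipschitz_on_subset[OF assms]) auto

lemma locally_lipschitz_onI:
  assumes "open \<Omega>" "\<And>x. x \<in> \<Omega> \<Longrightarrow> \<exists>r>0. \<exists>L. L-lipschitz_on (ball x r) u"
  shows "locally_lipschitz_on \<Omega> u"
  unfolding locally_lipschitz_on_def
proof
  fix x assume x: "x \<in> \<Omega>"
  obtain r L where r: "r > 0" "L-lipschitz_on (ball x r) u" using assms(2)[OF x] by blast
  obtain s where s: "s > 0" "ball x s \<subseteq> \<Omega>" using assms(1) x open_contains_ball by blast
  have "ball x (min r s) \<subseteq> \<Omega>" "L-lipschitz_on (ball x (min r s)) u"
    using s(2) by (auto intro: lipschitz_on_subset[OF r(2)])
  then show "\<exists>r>0. ball x r \<subseteq> \<Omega> \<and> (\<exists>L. L-lipschitz_on (ball x r) u)"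
    using r(1) s(1) by (intro exI[of _ "min r s"]) auto
qed

lemma lipschitz_scaled_dist:
  fixes z :: "'a::metric_space"
  assumes "0 \<le> \<delta>"
  shows "\<delta>-lipschitz_on X (\<lambda>y. \<delta> * dist z y)" "\<delta>-lipschitz_on X (\<lambda>y. - (\<delta> * dist z y))"
proof -
  have "1-lipschitz_on X (dist z)"
    by (rule lipschitz_onI) (use abs_dist_diff_le[of _ z] in \<open>auto simp: dist_real_def dist_commute\<close>)
  from lipschitz_on_cmult_real_nonneg[OF this assms]
  show "\<delta>-lipschitz_on X (\<lambda>y. \<delta> * dist z y)" by simp
  then show "\<delta>-lipschitz_on X (\<lambda>y. - (\<delta> * dist z y))" by simp
qed

lemma slope_radial_le:
  fixes x z :: "'a::metric_space"
  assumes p: "(p has_real_derivative D) (at (dist x z))" and D: "0 \<le> D"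
  shows "slope (\<lambda>y. p (dist x y)) z \<le> ereal D"
  unfolding slope_le_iff[OF D]
proof (intro allI impI)
  fix k assume k: "D < k"
  let ?s = "dist x z"
  have "((\<lambda>t. \<bar>(p t - p ?s) / (t - ?s)\<bar>) \<longlongrightarrow> \<bar>D\<bar>) (at ?s)"
    using p by (intro tendsto_rabs) (simp add: has_field_derivative_iff)
  then have "\<forall>\<^sub>F t in at ?s. \<bar>(p t - p ?s) / (t - ?s)\<bar> < k"
    using k D by (intro order_tendstoD(2)[where y="\<bar>D\<bar>"]) auto
  then have "\<forall>\<^sub>F t in nhds ?s. \<bar>p t - p ?s\<bar> \<le> k * \<bar>t - ?s\<bar>"
    unfolding eventually_at_filter by eventually_elim (auto simp: abs_divide divide_less_eq)
  then have "\<forall>\<^sub>F y in at z. \<bar>p (dist x y) - p ?s\<bar> \<le> k * \<bar>dist x y - ?s\<bar>"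
    by (rule eventually_compose_filterlim) (intro tendsto_intros)
  then show "\<forall>\<^sub>F y in at z. \<bar>p (dist x y) - p ?s\<bar> \<le> k * dist z y"
  proof eventually_elim
    case (elim y)
    have "\<bar>dist x y - dist x z\<bar> \<le> dist z y"
      using abs_dist_diff_le[of y x z] by (simp add: dist_commute)
    then have "k * \<bar>dist x y - ?s\<bar> \<le> k * dist z y" using k D by (intro mult_left_mono) auto
    with elim show ?case by linarith
  qed
qed

text \<open>Almost-geodesics from \<open>z\<close> to \<open>x\<close> decrease the distance to \<open>x\<close> at almost unit rate.\<close>

lemma slope_minus_radial_ge:
  fixes x z :: "'a::metric_space"
  assumes ls: "length_space TYPE('a)"
    and p: "(p has_real_derivative D) (at (dist x z))" and D: "x = z \<Longrightarrow> D = 0"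
  shows "ereal D \<le> slope_minus (\<lambda>y. p (dist x y)) z"
proof (rule slope_minus_geI)
  fix k e :: real assume k: "0 \<le> k" "k < D" and e: "0 < e"
  let ?s = "dist x z"
  have s: "0 < ?s" using D k by auto
  define k' where "k' = (k + D) / 2"
  have k': "k < k'" "k' < D" "0 < k'" using k by (auto simp: k'_def)
  \<comment> \<open>\<open>\<kappa>\<close> is the guaranteed rate of approach to x; it is chosen so
    that \<open>k' * \<kappa>\<close> is the midpoint of k and \<open>k'\<close> and hence still
    exceeds k.\<close>
  define \<kappa> where "\<kappa> = (k + k') / (2 * k')"
  have \<kappa>: "0 < \<kappa>" "\<kappa> < 1" "k' * \<kappa> = (k + k') / 2" using k k' by (auto simp: \<kappa>_def field_simps)
  have "((\<lambda>t. (p t - p ?s) / (t - ?s)) \<longlongrightarrow> D) (at ?s)"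
    using p by (simp add: has_field_derivative_iff)
  then have "\<forall>\<^sub>F t in at ?s. k' < (p t - p ?s) / (t - ?s)"
    using k' by (intro order_tendstoD(1))
  then obtain d where d: "d > 0"
    and pd: "\<And>t. t \<noteq> ?s \<Longrightarrow> \<bar>t - ?s\<bar> < d \<Longrightarrow> k' < (p t - p ?s) / (t - ?s)"
    by (auto simp: eventually_at dist_real_def)
  define \<tau> where "\<tau> = Min {e/2, d/2, ?s/2}"
  have \<tau>: "0 < \<tau>" "\<tau> < e" "\<tau> < d" "\<tau> < ?s" using e d s by (auto simp: \<tau>_def min_def)
  \<comment> \<open>The excess length is a fraction \<open>1 - \<kappa>\<close> of the running time
    \<open>\<tau>\<close>: after time \<open>\<tau>\<close> at most
    \<open>L - \<tau> = ?s - \<kappa> * \<tau>\<close> remains to x.\<close>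
  define L where "L = ?s + (1 - \<kappa>) * \<tau>"
  have L: "dist z x < L" using \<kappa> \<tau> by (simp add: L_def dist_commute)
  obtain \<xi> where \<xi>: "1-lipschitz_on UNIV \<xi>" "\<xi> 0 = z" "\<xi> L = x"
    using length_space_curve[OF ls L] by (metis order_refl)
  have zy: "dist z (\<xi> \<tau>) \<le> \<tau>"
    using lipschitz_onD[OF \<xi>(1), of 0 \<tau>] \<xi>(2) \<tau> by (simp add: dist_real_def)
  have "dist x (\<xi> \<tau>) \<le> \<bar>L - \<tau>\<bar>"
    using lipschitz_onD[OF \<xi>(1), of L \<tau>] \<xi>(3) by (simp add: dist_real_def)
  moreover have "L - \<tau> = ?s - \<kappa> * \<tau>" by (simp add: L_def algebra_simps)
  moreover have "\<kappa> * \<tau> < \<tau>" using \<kappa> \<tau> by simp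
  ultimately have xy: "dist x (\<xi> \<tau>) \<le> ?s - \<kappa> * \<tau>" using \<tau> by linarith
  let ?t = "dist x (\<xi> \<tau>)"
  have ts: "?t < ?s" using xy mult_pos_pos[OF \<kappa>(1) \<tau>(1)] by linarith
  have "?s - ?t \<le> \<tau>" using zy dist_triangle[of x z "\<xi> \<tau>"] by (simp add: dist_commute)
  then have "k' < (p ?t - p ?s) / (?t - ?s)" using pd[of ?t] ts \<tau> by auto
  then have "k' * (?s - ?t) < p ?s - p ?t" using ts by (simp add: field_simps)
  moreover have "k' * (\<kappa> * \<tau>) \<le> k' * (?s - ?t)" using k' xy by (intro mult_left_mono) auto
  moreover have "k * \<tau> < k' * \<kappa> * \<tau>" using \<kappa> k' \<tau> by simp
  moreover have "k * dist z (\<xi> \<tau>) \<le> k * \<tau>" using k zy by (intro mult_left_mono)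
  ultimately have "k * dist z (\<xi> \<tau>) < p ?s - p ?t" by (simp add: mult.assoc)
  then show "\<exists>y. dist z y < e \<and> k * dist z y < p ?s - p (dist x y)"
    using zy \<tau> by (intro exI[of _ "\<xi> \<tau>"]) auto
qed

lemma locally_lipschitz_radial:
  fixes x :: "'a::metric_space"
  assumes "open \<Omega>" and p: "\<And>s. (p has_real_derivative D s) (at s)" and D: "continuous_on UNIV D"
  shows "locally_lipschitz_on \<Omega> (\<lambda>y. p (dist x y))"
proof (rule locally_lipschitz_onI[OF assms(1)])
  fix z
  let ?I = "{dist x z - 1..dist x z + 1}"
  have "compact (D ` ?I)"
    by (intro compact_continuous_image continuous_on_subset[OF D]) auto
  then obtain B where B: "\<And>s. s \<in> ?I \<Longrightarrow> \<bar>D s\<bar> \<le> B"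
    using compact_imp_bounded bounded_iff by (metis imageI real_norm_def)
  have B0: "0 \<le> B" using B[of "dist x z"] by auto
  have "B-lipschitz_on (ball z 1) (\<lambda>y. p (dist x y))"
  proof (rule lipschitz_onI[OF _ B0])
    fix y y' assume "y \<in> ball z 1" "y' \<in> ball z 1"
    then have I: "dist x y \<in> ?I" "dist x y' \<in> ?I"
      using abs_dist_diff_le[of y x z] abs_dist_diff_le[of y' x z] by (auto simp: dist_commute abs_le_iff)
    have "norm (p (dist x y) - p (dist x y')) \<le> B * norm (dist x y - dist x y')"
      by (rule field_differentiable_bound[of ?I p D])
        (use p B I in \<open>auto intro: has_field_derivative_at_within\<close>)
    also have "\<dots> \<le> B * dist y y'"
      using abs_dist_diff_le[of y x y'] B0 by (intro mult_left_mono) (auto simp: dist_commute)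
    finally show "dist (p (dist x y)) (p (dist x y')) \<le> B * dist y y'" by (simp add: dist_real_def)
  qed
  then show "\<exists>r>0. \<exists>L. L-lipschitz_on (ball z r) (\<lambda>y. p (dist x y))"
    using zero_less_one by blast
qed

text \<open>The chain rule bounds \<open>slope\<close> above and almost-geodesics bound
  \<open>slope_minus\<close> below by the same number, so the two slopes agree. At the apex the
  profile has a minimum and \<open>slope_minus\<close> vanishes, hence the condition
  \<open>D 0 = 0\<close>.\<close>

lemma radial_test_functions:
  fixes x :: "'a::metric_space"
  assumes ls: "length_space TYPE('a)" and op: "open \<Omega>"
    and p: "\<And>s. (p has_real_derivative D s) (at s)" and D: "continuous_on UNIV D"
      "D 0 = 0" "\<And>s. 0 \<le> s \<Longrightarrow> 0 \<le> D s"
  shows "slope (\<lambda>y. p (dist x y)) z = ereal (D (dist x z))"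
    and "(\<lambda>y. p (dist x y)) \<in> C_lower \<Omega>"
    and "(\<lambda>y. - p (dist x y)) \<in> C_upper \<Omega>"
proof -
  have 1: "slope (\<lambda>y. p (dist x y)) z \<le> ereal (D (dist x z))" for z
    using slope_radial_le[OF p] D by simp
  have 2: "ereal (D (dist x z)) \<le> slope_minus (\<lambda>y. p (dist x y)) z" for z
    by (rule slope_minus_radial_ge[OF ls p]) (simp add: D)
  show 3: "slope (\<lambda>y. p (dist x y)) z = ereal (D (dist x z))" for z
    using 1 2 slope_minus_le_slope order.trans order.antisym by metis
  have 4: "slope_minus (\<lambda>y. p (dist x y)) z = slope (\<lambda>y. p (dist x y)) z" for z
    using 1 2 slope_minus_le_slope order.trans order.antisym by metis
  have lip: "locally_lipschitz_on \<Omega> (\<lambda>y. p (dist x y))"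
    by (rule locally_lipschitz_radial[OF op p D(1)])
  have cont: "continuous_on \<Omega> (slope (\<lambda>y. p (dist x y)))"
    unfolding 3
    by (intro continuous_on_ereal continuous_on_compose2[OF D(1)] continuous_intros) auto
  show "(\<lambda>y. p (dist x y)) \<in> C_lower \<Omega>"
    using lip cont 4 by (simp add: C_lower_def)
  show "(\<lambda>y. - p (dist x y)) \<in> C_upper \<Omega>"
    using lip cont 4 unfolding C_upper_def
    by (simp add: slope_uminus slope_plus_uminus locally_lipschitz_on_def)
qed


subsection \<open>Semicontinuity and derivatives on the line\<close>

lemma continuous_on_imp_usc_on: "continuous_on S u \<Longrightarrow> usc_on S u"
  unfolding continuous_on_def usc_on_def by (blast intro: order_tendstoD)

lemma continuous_on_imp_lsc_on: "continuous_on S u \<Longrightarrow> lsc_on S u"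
  unfolding continuous_on_def lsc_on_def by (blast intro: order_tendstoD)

lemma lsc_on_subset: "lsc_on T u \<Longrightarrow> S \<subseteq> T \<Longrightarrow> lsc_on S u"
  unfolding lsc_on_def by (meson at_le filter_leD subsetD)

lemma lsc_on_add_continuous:
  assumes "lsc_on S u" "continuous_on S v"
  shows "lsc_on S (\<lambda>x. u x + v x)"
  unfolding lsc_on_def
proof (intro ballI allI impI)
  fix x a assume x: "x \<in> S" and a: "a < u x + v x"
  define e where "e = (u x + v x - a) / 2"
  have "\<forall>\<^sub>F y in at x within S. u x - e < u y"
    using assms(1) x a unfolding lsc_on_def e_def by force
  moreover have "\<forall>\<^sub>F y in at x within S. v x - e < v y"
    using assms(2) x a by (intro order_tendstoD(1)[of v "v x"]) (auto simp: continuous_on_def e_def)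
  ultimately show "\<forall>\<^sub>F y in at x within S. a < u y + v y"
    by eventually_elim (simp add: e_def field_simps)
qed

lemma lsc_on_attains_inf:
  fixes g :: "'a::topological_space \<Rightarrow> real"
  assumes S: "compact S" "S \<noteq> {}" and g: "lsc_on S g"
  shows "\<exists>x\<in>S. \<forall>y\<in>S. g x \<le> g y"
proof (rule ccontr)
  assume "\<not> ?thesis"
  then have less: "\<exists>y\<in>S. g y < g x" if "x \<in> S" for x using that by (auto simp: not_le)
  have "\<exists>U. open U \<and> S \<inter> U = {x\<in>S. a < g x}" for a
  proof -
    have "\<forall>x\<in>{x\<in>S. a < g x}. \<exists>U. open U \<and> x \<in> U \<and> S \<inter> U \<subseteq> {x\<in>S. a < g x}"
    proof clarify
      fix x assume "x \<in> S" "a < g x"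
      then have "\<forall>\<^sub>F y in at x within S. a < g y" using g by (auto simp: lsc_on_def)
      then obtain U where "open U" "x \<in> U" "\<And>y. y \<in> U \<Longrightarrow> y \<noteq> x \<Longrightarrow> y \<in> S \<Longrightarrow> a < g y"
        by (auto simp: eventually_at_topological)
      then show "\<exists>U. open U \<and> x \<in> U \<and> S \<inter> U \<subseteq> {x\<in>S. a < g x}"
        using \<open>a < g x\<close> by (intro exI[of _ U]) auto
    qed
    then obtain U where U: "\<And>x. x \<in> S \<Longrightarrow> a < g x \<Longrightarrow> open (U x) \<and> x \<in> U x \<and> S \<inter> U x \<subseteq> {x\<in>S. a < g x}"
      by (metis (mono_tags, lifting) mem_Collect_eq)
    then show ?thesis
      by (intro exI[of _ "\<Union>(U ` {x\<in>S. a < g x})"]) blast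
  qed
  then obtain U where U: "\<And>a. open (U a)" "\<And>a. S \<inter> U a = {x\<in>S. a < g x}" by metis
  \<comment> \<open>Without a minimum the sets where g exceeds some value \<open>g y\<close> cover
    S. In a finite subcover, the y with least value lies in none of the sets.\<close>
  have "S \<subseteq> (\<Union>y\<in>S. U (g y))" using less U(2) by blast
  then obtain T where T: "T \<subseteq> S" "finite T" "S \<subseteq> (\<Union>y\<in>T. U (g y))"
    using compactE_image[OF S(1), of S "\<lambda>y. U (g y)"] U(1) by metis
  have "T \<noteq> {}" using T(3) S(2) by auto
  then obtain y where y: "y \<in> T" "\<And>z. z \<in> T \<Longrightarrow> g y \<le> g z"
    using arg_min_if_finite(1)[OF T(2)] arg_min_least[OF T(2)] by metis
  then obtain z where "z \<in> T" "y \<in> U (g z)" using T by blast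
  then have "g z < g y" using U(2)[of "g z"] y(1) T(1) by blast
  then show False using y(2)[OF \<open>z \<in> T\<close>] by simp
qed

lemma continuous_on_cball_bound:
  fixes f :: "'a::metric_space \<Rightarrow> real"
  assumes "open \<Omega>" "continuous_on \<Omega> f" "x \<in> \<Omega>" "f x < M"
  obtains R where "R > 0" "cball x R \<subseteq> \<Omega>" "\<And>y. y \<in> cball x R \<Longrightarrow> f y < M"
proof -
  have "isCont f x" using assms continuous_on_eq_continuous_at by blast
  then have "\<forall>\<^sub>F y in nhds x. f y < M"
    using assms(4) by (intro order_tendstoD(2)[of f "f x"]) (auto simp: isCont_def tendsto_at_iff_tendsto_nhds)
  moreover have "\<forall>\<^sub>F y in nhds x. y \<in> \<Omega>" using assms by (intro eventually_nhds_in_open)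
  ultimately have "\<forall>\<^sub>F y in nhds x. y \<in> \<Omega> \<and> f y < M" by eventually_elim auto
  then obtain d where "d > 0" "\<And>y. dist y x < d \<Longrightarrow> y \<in> \<Omega> \<and> f y < M"
    by (auto simp: eventually_nhds_metric)
  then show ?thesis by (intro that[of "d/2"]) (auto simp: dist_commute)
qed

text \<open>The one-sided form serves piecewise affine functions tested at a node; left-hand
  versions come from reflecting time.\<close>

lemma derivative_ge_right:
  fixes \<phi> :: "real \<Rightarrow> real"
  assumes "(\<phi> has_real_derivative D) (at t)" "\<forall>\<^sub>F s in at_right t. a * (s - t) \<le> \<phi> s - \<phi> t"
  shows "a \<le> D"
proof (rule tendsto_lowerbound)
  show "((\<lambda>s. (\<phi> s - \<phi> t) / (s - t)) \<longlongrightarrow> D) (at_right t)"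
    using assms(1) unfolding has_field_derivative_iff by (rule filterlim_mono) (auto simp: at_le)
  show "\<forall>\<^sub>F s in at_right t. a \<le> (\<phi> s - \<phi> t) / (s - t)"
    using assms(2) eventually_at_right_less[of t]
    by eventually_elim (simp add: pos_le_divide_eq)
qed simp

lemma derivative_reflect:
  fixes \<phi> :: "real \<Rightarrow> real"
  assumes "(\<phi> has_real_derivative D) (at t)"
  shows "((\<lambda>s. \<phi> (- s)) has_real_derivative - D) (at (- t))"
  using assms DERIV_mirror[of \<phi> D "- t"] by simp

lemma C1_imp_deriv:
  fixes \<phi> :: "real \<Rightarrow> real"
  assumes "\<phi> C1_differentiable_on UNIV"
  shows "(\<phi> has_real_derivative deriv \<phi> t) (at t)"
  using assms unfolding C1_differentiable_on_def
  by (metis DERIV_deriv_iff_real_differentiable UNIV_I has_real_derivative_iff_has_vector_derivative real_differentiable_def)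

lemma C1_differentiable_realI:
  fixes \<phi> :: "real \<Rightarrow> real"
  assumes "\<And>t. (\<phi> has_real_derivative D t) (at t)" "continuous_on UNIV D"
  shows "\<phi> C1_differentiable_on UNIV"
  using assms unfolding C1_differentiable_on_def has_real_derivative_iff_has_vector_derivative by blast

text \<open>
  A smooth substitute for the cone \<open>k * s\<close>: its slope vanishes at the apex, as membership of
  the classes of test functions requires there.
\<close>

definition smooth_cone :: "real \<Rightarrow> real \<Rightarrow> real \<Rightarrow> real \<Rightarrow> real" where
  "smooth_cone k \<eta> N s = k * (sqrt (s\<^sup>2 + \<eta>\<^sup>2) - \<eta>) + N * s\<^sup>2"

definition cone_deriv :: "real \<Rightarrow> real \<Rightarrow> real \<Rightarrow> real \<Rightarrow> real" where
  "cone_deriv k \<eta> N s = k * s / sqrt (s\<^sup>2 + \<eta>\<^sup>2) + 2 * N * s"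

context
  fixes k \<eta> N :: real
  assumes pos: "0 < k" "0 < \<eta>" "0 \<le> N"
begin

lemma sum_squares_pos: "0 < s\<^sup>2 + \<eta>\<^sup>2"
  using pos by (simp add: add_nonneg_pos)

lemma cone_has_derivative: "(smooth_cone k \<eta> N has_real_derivative cone_deriv k \<eta> N s) (at s)"
  unfolding smooth_cone_def[abs_def] cone_deriv_def using sum_squares_pos[of s]
  by (auto intro!: derivative_eq_intros simp: field_simps)

lemma continuous_on_cone_deriv: "continuous_on UNIV (cone_deriv k \<eta> N)"
  unfolding cone_deriv_def[abs_def] using sum_squares_pos
  by (intro continuous_intros) (metis less_irrefl real_sqrt_eq_zero_cancel_iff)

lemma cone_deriv_0: "cone_deriv k \<eta> N 0 = 0"
  by (simp add: cone_deriv_def)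

lemma cone_deriv_nonneg: "0 \<le> s \<Longrightarrow> 0 \<le> cone_deriv k \<eta> N s"
  using pos by (simp add: cone_deriv_def)

lemma sqrt_sum_le: "0 \<le> s \<Longrightarrow> sqrt (s\<^sup>2 + \<eta>\<^sup>2) \<le> s + \<eta>"
  using pos by (intro real_le_lsqrt) (auto simp: power2_sum)

lemma cone_0: "smooth_cone k \<eta> N 0 = 0"
  using pos by (simp add: smooth_cone_def)

lemma cone_le: "0 \<le> s \<Longrightarrow> smooth_cone k \<eta> N s \<le> k * s + N * s\<^sup>2"
  using pos sqrt_sum_le[of s] by (simp add: smooth_cone_def)

lemma cone_ge_quadratic: "N * s\<^sup>2 \<le> smooth_cone k \<eta> N s"
proof -
  have "\<eta> \<le> sqrt (s\<^sup>2 + \<eta>\<^sup>2)" using pos by (intro real_le_rsqrt) auto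
  then show ?thesis using pos by (simp add: smooth_cone_def)
qed

lemma cone_ge_linear: "k * (\<bar>s\<bar> - \<eta>) \<le> smooth_cone k \<eta> N s"
proof -
  have "\<bar>s\<bar> \<le> sqrt (s\<^sup>2 + \<eta>\<^sup>2)" by (intro real_le_rsqrt) auto
  then have "k * (\<bar>s\<bar> - \<eta>) \<le> k * (sqrt (s\<^sup>2 + \<eta>\<^sup>2) - \<eta>)" using pos by (intro mult_left_mono) auto
  moreover have "0 \<le> N * s\<^sup>2" using pos by simp
  ultimately show ?thesis unfolding smooth_cone_def by linarith
qed

text \<open>Rounding costs at most the factor \<open>s / (s + \<eta>)\<close>, since the root is at
  most \<open>s + \<eta>\<close>. The hypothesis says that this is affordable at \<open>s0\<close>,
  and the reserve \<open>(k - k1) * s\<close> only grows with s.\<close>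

lemma cone_deriv_gt:
  assumes "0 < k1" "k1 * (s0 + \<eta>) < k * s0" "0 < s0" "s0 \<le> s"
  shows "k1 < cone_deriv k \<eta> N s"
proof -
  have "k1 * \<eta> < (k - k1) * s0" using assms by (simp add: algebra_simps)
  moreover have "0 < (k - k1) * s0"
    by (rule le_less_trans[OF _ calculation]) (use assms pos in simp)
  then have "k1 < k" using assms by (simp add: zero_less_mult_iff)
  then have "(k - k1) * s0 \<le> (k - k1) * s" using assms by simp
  ultimately have "k1 * (s + \<eta>) < k * s" by (simp add: algebra_simps)
  moreover have "k1 * sqrt (s\<^sup>2 + \<eta>\<^sup>2) \<le> k1 * (s + \<eta>)"
    using assms sqrt_sum_le[of s] by (intro mult_left_mono) auto
  ultimately have "k1 < k * s / sqrt (s\<^sup>2 + \<eta>\<^sup>2)"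
    using sum_squares_pos[of s] by (simp add: pos_less_divide_eq)
  moreover have "0 \<le> 2 * N * s" using assms pos by simp
  ultimately show ?thesis unfolding cone_deriv_def by linarith
qed

end

text \<open>The matrix of the supersolution condition for one curve and one w, named so that their
  existence can be treated apart from the test.\<close>

definition super_test ::
    "('a::metric_space \<Rightarrow> real) \<Rightarrow> ('a \<Rightarrow> real) \<Rightarrow> 'a \<Rightarrow> real \<Rightarrow> real \<Rightarrow> (real \<Rightarrow> 'a) \<Rightarrow> (real \<Rightarrow> real) \<Rightarrow> bool" where
  "super_test f u x r \<epsilon> \<xi> w \<longleftrightarrow>
     (let J = {t. exit_time_minus UNIV (ball x r) \<xi> < ereal t \<and>
                  ereal t < exit_time_plus UNIV (ball x r) \<xi>}
      in lsc_on J w \<and> w 0 = u x \<and>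
         (\<forall>t\<in>J. w t \<ge> u (\<xi> t) - \<epsilon>) \<and>
         (\<forall>\<phi>::real \<Rightarrow> real. \<forall>t0\<in>J.
            \<phi> C1_differentiable_on UNIV \<longrightarrow> local_min_at (\<lambda>t. w t - \<phi> t) t0 \<longrightarrow>
            \<bar>deriv \<phi> t0\<bar> \<ge> f (\<xi> t0) - \<epsilon>))"

lemma local_c_supersolution_iff:
  "local_c_supersolution \<Omega> f u \<longleftrightarrow> lsc_on \<Omega> u \<and>
     (\<forall>x\<in>\<Omega>. \<exists>r>0. ball x r \<subseteq> \<Omega> \<and>
        (\<forall>\<epsilon>>0. \<exists>\<xi>\<in>admissible_curves x UNIV UNIV. \<exists>w. super_test f u x r \<epsilon> \<xi> w))"
  unfolding local_c_supersolution_def super_test_def ..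

lemma continuous_on_smooth_cone: "0 < k \<Longrightarrow> 0 < \<eta> \<Longrightarrow> 0 \<le> N \<Longrightarrow> continuous_on UNIV (smooth_cone k \<eta> N)"
  by (rule DERIV_continuous_on) (rule has_field_derivative_at_within[OF cone_has_derivative])

lemma cone_deriv_linear_le:
  assumes "0 < k" "0 < \<eta>"
  shows "\<bar>cone_deriv k \<eta> 0 s\<bar> \<le> k"
proof -
  have "\<bar>s\<bar> \<le> sqrt (s\<^sup>2 + \<eta>\<^sup>2)" by (intro real_le_rsqrt) auto
  then have "k * \<bar>s\<bar> \<le> k * sqrt (s\<^sup>2 + \<eta>\<^sup>2)" using assms by (intro mult_left_mono) auto
  then show ?thesis using assms sum_squares_pos[of 1 \<eta> 0 s]
    by (simp add: cone_deriv_def abs_mult abs_divide pos_divide_le_eq)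
qed


subsection \<open>Subsolutions are Lipschitz\<close>

lemma lipschitz_on_realI:
  fixes u :: "'a::metric_space \<Rightarrow> real"
  assumes "0 \<le> M" "\<And>x y. x \<in> X \<Longrightarrow> y \<in> X \<Longrightarrow> u y - u x \<le> M * dist x y"
  shows "M-lipschitz_on X u"
proof (rule lipschitz_onI[OF _ assms(1)])
  fix x y assume "x \<in> X" "y \<in> X"
  then show "dist (u x) (u y) \<le> M * dist x y"
    using assms(2)[of x y] assms(2)[of y x] by (auto simp: dist_real_def dist_commute)
qed

text \<open>Asking for every \<open>M > f x\<close>, with a radius depending on M, leaves room for
  the losses of the comparison arguments; letting M tend to \<open>f x\<close> recovers the slope
  bound.\<close>

definition locally_dominated :: "'a::metric_space set \<Rightarrow> ('a \<Rightarrow> real) \<Rightarrow> ('a \<Rightarrow> real) \<Rightarrow> bool" where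
  "locally_dominated \<Omega> f u \<longleftrightarrow> (\<forall>x\<in>\<Omega>. \<forall>M>f x. \<exists>R>0. M-lipschitz_on (ball x R) u)"

lemma locally_dominated_imp_locally_lipschitz:
  assumes "open \<Omega>" "locally_dominated \<Omega> f u"
  shows "locally_lipschitz_on \<Omega> u"
proof (rule locally_lipschitz_onI[OF assms(1)])
  fix x assume "x \<in> \<Omega>"
  moreover have "f x < f x + 1" by simp
  ultimately show "\<exists>r>0. \<exists>L. L-lipschitz_on (ball x r) u"
    using assms(2) unfolding locally_dominated_def by blast
qed

lemma locally_dominated_imp_slope_le:
  assumes "locally_dominated \<Omega> f u" "x \<in> \<Omega>"
  shows "slope u x \<le> ereal (f x)"
proof (rule ereal_le_epsilon2)
  fix e :: real assume "0 < e"
  then have "f x < f x + e" by simp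
  then obtain R where "R > 0" "(f x + e)-lipschitz_on (ball x R) u"
    using assms unfolding locally_dominated_def by blast
  from slope_le_lipschitz[OF this(2,1)] show "slope u x \<le> ereal (f x) + ereal e" by simp
qed

text \<open>If u gained more than \<open>M * L\<close> along an almost-geodesic, a line of slope
  \<open>K > M\<close> would touch u along the curve from above at some positive time, and the test
  would give \<open>K \<le> f \<le> M\<close> there.\<close>

lemma c_subsolution_increment_le:
  fixes u :: "'a::metric_space \<Rightarrow> real"
  assumes ls: "length_space TYPE('a)" and c: "c_subsolution \<Omega> f u" and u: "continuous_on \<Omega> u"
    and ball: "ball x0 (4 * R) \<subseteq> \<Omega>" and f: "\<And>z. z \<in> ball x0 (4 * R) \<Longrightarrow> f z \<le> M"
    and M: "0 \<le> M" and xy: "x \<in> ball x0 R" and L: "dist x y < L" "L < 2 * R"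
  shows "u y - u x \<le> M * L"
proof (rule ccontr)
  assume "\<not> ?thesis"
  then have less: "M * L < u y - u x" by simp
  have L0: "0 < L" using L(1) by (rule le_less_trans[OF zero_le_dist])
  define K where "K = (M + (u y - u x) / L) / 2"
  have K: "M < K" "K * L < u y - u x" 
  proof -
    have "M < (u y - u x) / L" using less L0 by (simp add: pos_less_divide_eq)
    then show "M < K" "K * L < u y - u x"
      using L0 less by (auto simp: K_def distrib_right)
  qed
  obtain \<xi> where \<xi>: "1-lipschitz_on UNIV \<xi>" "\<And>t. t \<le> 0 \<Longrightarrow> \<xi> t = x" "\<And>t. L \<le> t \<Longrightarrow> \<xi> t = y"
    using length_space_curve[OF ls L(1)] by blast
  have dx: "dist x (\<xi> t) \<le> L" for t
  proof -
    consider "t \<le> 0" | "L \<le> t" | "0 < t" "t < L" by linarith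
    then show ?thesis
    proof cases
      case 3
      then show ?thesis
        using lipschitz_onD[OF \<xi>(1), of 0 t] \<xi>(2)[of 0] by (simp add: dist_real_def)
    qed (use \<xi> L(1) L0 in auto)
  qed
  have in_ball: "\<xi> t \<in> ball x0 (4 * R)" for t
    using dist_triangle[of x0 "\<xi> t" x] dx[of t] xy L(2) L0 by simp
  have \<xi>_cont: "continuous_on UNIV \<xi>" by (rule lipschitz_on_continuous_on[OF \<xi>(1)])
  have "continuous_on {0..L} (\<lambda>t. u (\<xi> t) - K * t)"
    using in_ball ball
    by (intro continuous_intros continuous_on_compose2[OF u] continuous_on_subset[OF \<xi>_cont]) auto
  then obtain t0 where t0: "t0 \<in> {0..L}"
    and max: "\<And>t. t \<in> {0..L} \<Longrightarrow> u (\<xi> t) - K * t \<le> u (\<xi> t0) - K * t0"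
    using continuous_attains_sup[of "{0..L}" "\<lambda>t. u (\<xi> t) - K * t"] L0 by auto
  have "u x < u (\<xi> t0) - K * t0"
    using max[of L] \<xi>(3)[of L] K(2) L0 by simp
  then have t0_pos: "0 < t0" using t0 \<xi>(2)[of 0] by (cases "t0 = 0") auto
  \<comment> \<open>The maximum may sit at \<open>t0 = L\<close>. It is still a local one, since the
    curve rests at y afterwards while \<open>- K * t\<close> decreases.\<close>
  have global: "u (\<xi> t) - K * t \<le> u (\<xi> t0) - K * t0" if "0 < t" for t
  proof (cases "t \<le> L")
    case False
    then have "u (\<xi> t) - K * t \<le> u (\<xi> L) - K * L"
      using \<xi>(3)[of t] \<xi>(3)[of L] M K by simp
    also have "\<dots> \<le> u (\<xi> t0) - K * t0" using max[of L] L0 by simp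
    finally show ?thesis .
  qed (use max that in simp)
  \<comment> \<open>The definition tests only at time 0, so the curve is shifted to start at the
    touching point.\<close>
  let ?\<zeta> = "\<lambda>t. \<xi> (t0 + t)"
  have "1-lipschitz_on UNIV ?\<zeta>"
  proof (rule lipschitz_onI)
    fix s t show "dist (?\<zeta> s) (?\<zeta> t) \<le> 1 * dist s t"
      using lipschitz_onD[OF \<xi>(1), of "t0 + s" "t0 + t"] by (simp add: dist_real_def)
  qed simp
  then have "?\<zeta> \<in> admissible_curves (\<xi> t0) UNIV \<Omega>"
    using in_ball ball by (auto simp: admissible_curves_def)
  moreover have "\<xi> t0 \<in> \<Omega>" using in_ball ball by blast
  moreover have "((*) K) C1_differentiable_on UNIV"
    by (rule C1_differentiable_realI[where D="\<lambda>_. K"]) (auto intro!: derivative_eq_intros)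
  moreover have "local_max_at (\<lambda>t. u (?\<zeta> t) - K * t) 0"
    unfolding local_max_at_def
  proof -
    have "\<forall>\<^sub>F t in nhds 0. - t0 < t"
      using t0_pos by (intro order_tendstoD(1)[OF filterlim_ident]) auto
    then show "\<forall>\<^sub>F t in nhds 0. u (?\<zeta> t) - K * t \<le> u (?\<zeta> 0) - K * 0"
    proof eventually_elim
      case (elim t)
      then show ?case using global[of "t0 + t"] by (simp add: algebra_simps)
    qed
  qed
  ultimately have "\<bar>deriv ((*) K) 0\<bar> \<le> f (\<xi> t0)"
    using c[unfolded c_subsolution_def, THEN conjunct2, rule_format, of "\<xi> t0" ?\<zeta> "(*) K"] by simp
  moreover have "deriv ((*) K) 0 = K" by (rule DERIV_imp_deriv) (auto intro!: derivative_eq_intros)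
  ultimately show False using f[OF in_ball, of t0] K M by simp
qed

lemma c_subsolution_imp_locally_dominated:
  fixes u :: "'a::metric_space \<Rightarrow> real"
  assumes ls: "length_space TYPE('a)" and op: "open \<Omega>" and f: "continuous_on \<Omega> f" "\<And>x. x \<in> \<Omega> \<Longrightarrow> 0 \<le> f x"
    and u: "continuous_on \<Omega> u" and c: "c_subsolution \<Omega> f u"
  shows "locally_dominated \<Omega> f u"
  unfolding locally_dominated_def
proof (intro ballI allI impI)
  fix x0 M assume x0: "x0 \<in> \<Omega>" and M: "f x0 < M"
  obtain R where R: "R > 0" "cball x0 R \<subseteq> \<Omega>" "\<And>y. y \<in> cball x0 R \<Longrightarrow> f y < M"
    using continuous_on_cball_bound[OF op f(1) x0 M] by blast
  have M0: "0 \<le> M" using f(2)[OF x0] M by simp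
  have *: "u y - u x \<le> M * dist x y" if xy: "x \<in> ball x0 (R/4)" "y \<in> ball x0 (R/4)" for x y
  proof -
    have d: "dist x y < R/2" using xy dist_triangle[of x y x0] by (simp add: dist_commute)
    \<comment> \<open>Lengths must exceed the distance strictly; the excess disappears in the limit
      below.\<close>
    have le: "u y - u x \<le> M * L" if "dist x y < L" "L < R/2" for L
      by (rule c_subsolution_increment_le[OF ls c u _ _ M0 xy(1) that(1)])
        (use R that in \<open>auto intro: less_imp_le simp: subset_iff\<close>)
    have lim: "((\<lambda>L. M * L) \<longlongrightarrow> M * dist x y) (at_right (dist x y))"
      by (intro tendsto_intros)
    have "\<forall>\<^sub>F L in at_right (dist x y). u y - u x \<le> M * L"
      using eventually_at_right_real[OF d] by eventually_elim (use le in auto)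
    then show ?thesis by (intro tendsto_lowerbound[OF lim]) auto
  qed
  have "M-lipschitz_on (ball x0 (R/4)) u"
    by (rule lipschitz_on_realI[OF M0 *])
  then show "\<exists>R>0. M-lipschitz_on (ball x0 R) u" using R(1) by (intro exI[of _ "R/4"]) auto
qed

text \<open>
  Ekeland's principle replaces the missing compactness: the maximum is attained up to the perturbation
  \<open>\<delta> * dist z\<close>, which is what \<open>\<psi>2\<close> in the definition is for. The quadratic part of the cone keeps
  the maximum point off the boundary.
\<close>

lemma s_subsolution_increment_le:
  fixes u :: "'a::complete_space \<Rightarrow> real"
  assumes ls: "length_space TYPE('a)" and op: "open \<Omega>"
    and u: "continuous_on \<Omega> u" and s: "s_subsolution \<Omega> f u"
    and R: "0 < R" "cball x R \<subseteq> \<Omega>" and M: "0 < M" "M < k"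
    and f: "\<And>z. z \<in> cball x R \<Longrightarrow> f z < M"
    and b: "\<And>z. z \<in> cball x R \<Longrightarrow> \<bar>u z - b\<bar> < 1"
    and y: "dist x y < R"
  shows "u y - u x \<le> k * dist x y + 4 / R\<^sup>2 * (dist x y)\<^sup>2"
proof (rule ccontr)
  \<comment> \<open>\<open>N * R\<^sup>2 = 4\<close> exceeds the oscillation of u on the ball, which
    is at most 2; this excludes boundary points.\<close>
  define N where "N = 4 / R\<^sup>2"
  define gap where "gap = u y - u x - k * dist x y - N * (dist x y)\<^sup>2"
  assume "\<not> ?thesis"
  then have gap: "0 < gap" by (simp add: gap_def N_def)
  have N: "0 \<le> N" "N * R\<^sup>2 = 4" using R by (auto simp: N_def)
  have "x \<in> \<Omega>" using R by auto
  \<comment> \<open>The touching point will satisfy \<open>u x + gap \<le> u z\<close>, so it stays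
    farther than \<open>s0\<close> from the apex, where the rounded cone is steep.\<close>
  then obtain s0 where s0: "s0 > 0" "\<And>z. z \<in> cball x s0 \<Longrightarrow> u z < u x + gap"
    using continuous_on_cball_bound[OF op u, of x "u x + gap"] gap by (metis less_add_same_cancel1)
  define \<delta> where "\<delta> = (k - M) / 2"
  have \<delta>: "0 < \<delta>" "M + \<delta> < k" using M by (auto simp: \<delta>_def field_simps)
  \<comment> \<open>Chosen so that \<open>k * \<eta>\<close> is exactly the reserve
    \<open>(k - (M + \<delta>)) * s0\<close> in the hypothesis of
    \<open>cone_deriv_gt\<close>.\<close>
  define \<eta> where "\<eta> = (k - (M + \<delta>)) * s0 / k"
  have \<eta>: "0 < \<eta>" using \<delta> M s0 by (simp add: \<eta>_def)
  have "(M + \<delta>) * \<eta> < k * \<eta>" using \<eta> \<delta> by simp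
  also have "k * \<eta> = (k - (M + \<delta>)) * s0" using M by (simp add: \<eta>_def)
  finally have \<eta>': "(M + \<delta>) * (s0 + \<eta>) < k * s0" by (simp add: algebra_simps)
  have k: "0 < k" using M by simp
  let ?p = "smooth_cone k \<eta> N"
  note pos = k \<eta> N(1)
  define F where "F v = ?p (dist x v) - u v" for v
  have p_cont: "continuous_on UNIV ?p"
    by (rule continuous_on_smooth_cone[OF pos])
  have F_cont: "continuous_on (cball x R) F"
    unfolding F_def
    by (intro continuous_intros continuous_on_compose2[OF p_cont] continuous_on_subset[OF u R(2)]) auto
  have F_ge: "N * (dist x v)\<^sup>2 - u v \<le> F v" for v
    unfolding F_def using cone_ge_quadratic[OF pos] by simp
  have bdd: "- (b + 1) \<le> F v" if "v \<in> cball x R" for v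
  proof -
    have "0 \<le> N * (dist x v)\<^sup>2" using N by simp
    then show ?thesis using F_ge[of v] b[OF that] by linarith
  qed
  \<comment> \<open>Starting Ekeland at y, not at x, transfers the assumed excess \<open>gap\<close>
    to z.\<close>
  obtain z where z: "z \<in> cball x R" "F z + \<delta> * dist y z \<le> F y"
    and min: "\<And>v. v \<in> cball x R \<Longrightarrow> F z \<le> F v + \<delta> * dist z v"
    using ekeland[OF closed_cball F_cont bdd _ \<delta>(1), of y] y by auto
  have Fy: "F y \<le> - u x - gap"
    using cone_le[OF pos, of "dist x y"] by (simp add: F_def gap_def)
  moreover have "0 \<le> \<delta> * dist y z" using \<delta> by simp
  ultimately have Fz: "F z \<le> - u x - gap" using z(2) by linarith
  have zR: "dist x z < R"
  proof (rule ccontr)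
    assume "\<not> dist x z < R"
    then have "dist x z = R" using z(1) by simp
    then have "4 - u z \<le> F z" using F_ge[of z] N(2) by simp
    then show False using Fz gap b[OF z(1)] b[of x] R(1) by (simp add: abs_less_iff)
  qed
  have "0 \<le> N * (dist x z)\<^sup>2" using N by simp
  then have "u x + gap \<le> u z" using F_ge[of z] Fz by linarith
  then have zs0: "s0 < dist x z" using s0(2)[of z] by force
  let ?\<psi>1 = "\<lambda>v. ?p (dist x v)" and ?\<psi>2 = "\<lambda>v. \<delta> * dist z v"
  have rad: "?\<psi>1 \<in> C_lower \<Omega>" "slope ?\<psi>1 z = ereal (cone_deriv k \<eta> N (dist x z))"
    using radial_test_functions(1,2)[OF ls op cone_has_derivative[OF pos] continuous_on_cone_deriv[OF pos]
        cone_deriv_0[OF pos] cone_deriv_nonneg[OF pos]] by blast+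
  have lip2: "\<delta>-lipschitz_on X ?\<psi>2" for X
    using \<delta> by (intro lipschitz_scaled_dist) simp
  have loc2: "locally_lipschitz_on \<Omega> ?\<psi>2"
    by (rule locally_lipschitz_onI[OF op]) (use lip2 zero_less_one in blast)
  have "local_max_at (\<lambda>v. u v - ?\<psi>1 v - ?\<psi>2 v) z"
    unfolding local_max_at_def
  proof -
    have "\<forall>\<^sub>F v in nhds z. v \<in> ball x R" using zR by (intro eventually_nhds_in_open) auto
    then show "\<forall>\<^sub>F v in nhds z. u v - ?\<psi>1 v - ?\<psi>2 v \<le> u z - ?\<psi>1 z - ?\<psi>2 z"
      by eventually_elim (use min in \<open>simp add: F_def algebra_simps ball_def less_imp_le\<close>)
  qed
  moreover have "z \<in> \<Omega>" using z(1) R(2) by auto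
  ultimately have "slope ?\<psi>1 z \<le> ereal (f z) + slope_star ?\<psi>2 z"
    using s rad(1) loc2 unfolding s_subsolution_def by blast
  also have "\<dots> \<le> ereal (f z) + ereal \<delta>"
    by (intro add_left_mono slope_star_le_lipschitz lip2)
  finally have "cone_deriv k \<eta> N (dist x z) \<le> f z + \<delta>" using rad(2) by simp
  moreover have "M + \<delta> < cone_deriv k \<eta> N (dist x z)"
    by (rule cone_deriv_gt[OF pos _ \<eta>' s0(1)]) (use M \<delta> zs0 in auto)
  ultimately show False using f[OF z(1)] by simp
qed

lemma s_subsolution_imp_locally_dominated:
  fixes u :: "'a::complete_space \<Rightarrow> real"
  assumes ls: "length_space TYPE('a)" and op: "open \<Omega>" and f: "continuous_on \<Omega> f" "\<And>x. x \<in> \<Omega> \<Longrightarrow> 0 \<le> f x"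
    and u: "continuous_on \<Omega> u" and s: "s_subsolution \<Omega> f u"
  shows "locally_dominated \<Omega> f u"
  unfolding locally_dominated_def
proof (intro ballI allI impI)
  fix x0 M assume x0: "x0 \<in> \<Omega>" and M: "f x0 < M"
  \<comment> \<open>\<open>M1\<close> bounds f near \<open>x0\<close>, k is the slope of the cone,
    and \<open>M - k\<close> absorbs its quadratic part.\<close>
  define M1 k where "M1 = f x0 + (M - f x0) / 3" and "k = f x0 + (M - f x0) * 2 / 3"
  have k: "f x0 < M1" "M1 < k" "k < M" using M by (auto simp: M1_def k_def field_simps)
  have M1: "0 < M1" using f(2)[OF x0] k by simp
  obtain R1 where R1: "R1 > 0" "cball x0 R1 \<subseteq> \<Omega>" "\<And>y. y \<in> cball x0 R1 \<Longrightarrow> f y < M1"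
    using continuous_on_cball_bound[OF op f(1) x0 k(1)] by blast
  have "continuous_on \<Omega> (\<lambda>z. \<bar>u z - u x0\<bar>)" by (intro continuous_intros u)
  then obtain R2 where R2: "R2 > 0" "\<And>y. y \<in> cball x0 R2 \<Longrightarrow> \<bar>u y - u x0\<bar> < 1"
    using continuous_on_cball_bound[OF op _ x0, of "\<lambda>z. \<bar>u z - u x0\<bar>" 1]
    by (metis abs_zero diff_self zero_less_one)
  define R where "R = min R1 R2 / 2"
  have R: "0 < R" using R1 R2 by (simp add: R_def)
  have sub: "cball x R \<subseteq> cball x0 R1 \<inter> cball x0 R2" if "x \<in> ball x0 R" for x
  proof
    fix v assume "v \<in> cball x R"
    then have "dist x0 v \<le> 2 * R" using that dist_triangle[of x0 v x] by simp
    then show "v \<in> cball x0 R1 \<inter> cball x0 R2" by (auto simp: R_def)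
  qed
  \<comment> \<open>On pairs at distance below \<open>2 * r\<close> the quadratic term is at most
    \<open>(M - k) * dist x y\<close>.\<close>
  define r where "r = min (R / 2) ((M - k) * R\<^sup>2 / 8)"
  have r: "0 < r" "2 * r \<le> R" "4 / R\<^sup>2 * (2 * r) \<le> M - k"
    using R k by (auto simp: r_def min_def field_simps)
  have *: "u y - u x \<le> M * dist x y" if xy: "x \<in> ball x0 r" "y \<in> ball x0 r" for x y
  proof -
    have d: "dist x y < 2 * r" using xy dist_triangle[of x y x0] by (simp add: dist_commute)
    have xR: "x \<in> ball x0 R" using xy r by simp
    have "u y - u x \<le> k * dist x y + 4 / R\<^sup>2 * (dist x y)\<^sup>2"
    proof (rule s_subsolution_increment_le[OF ls op u s R _ M1 k(2), where b="u x0"])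
      show "cball x R \<subseteq> \<Omega>" using sub[OF xR] R1(2) by blast
      show "f z < M1" "\<bar>u z - u x0\<bar> < 1" if "z \<in> cball x R" for z
        using sub[OF xR] that R1(3) R2(2) by blast+
    qed (use d r in linarith)
    also have "4 / R\<^sup>2 * (dist x y)\<^sup>2 = 4 / R\<^sup>2 * dist x y * dist x y" by (simp add: power2_eq_square)
    also have "4 / R\<^sup>2 * dist x y \<le> 4 / R\<^sup>2 * (2 * r)" using d by (intro mult_left_mono) auto
    then have "4 / R\<^sup>2 * dist x y * dist x y \<le> (M - k) * dist x y"
      using r(3) by (intro mult_right_mono) auto
    finally show ?thesis by (simp add: algebra_simps)
  qed
  have "M-lipschitz_on (ball x0 r) u"
    by (rule lipschitz_on_realI[OF _ *]) (use M1 k in auto)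
  then show "\<exists>R>0. M-lipschitz_on (ball x0 R) u" using r(1) by blast
qed


subsection \<open>Supersolutions decrease at rate \<open>f\<close>\<close>

text \<open>A curve of speed at most one needs at least time r to leave the ball.\<close>

lemma abs_less_imp_before_exit:
  assumes \<xi>: "1-lipschitz_on UNIV \<xi>" "\<xi> 0 = x" and t: "\<bar>t\<bar> < r"
  shows "exit_time_minus UNIV (ball x r) \<xi> < ereal t" "ereal t < exit_time_plus UNIV (ball x r) \<xi>"
proof -
  have "\<xi> s \<in> ball x r" if "\<bar>s\<bar> < r" for s
    using lipschitz_onD[OF \<xi>(1), of 0 s] \<xi>(2) that by (simp add: dist_real_def)
  then have *: "r \<le> \<bar>s\<bar>" if "\<xi> s \<notin> ball x r" for s using that not_le by blast
  have "ereal r \<le> exit_time_plus UNIV (ball x r) \<xi>"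
    unfolding exit_time_plus_def using * by (intro Inf_greatest) fastforce
  moreover have "exit_time_minus UNIV (ball x r) \<xi> \<le> ereal (- r)"
    unfolding exit_time_minus_def using * by (intro Sup_least) fastforce
  ultimately show "exit_time_minus UNIV (ball x r) \<xi> < ereal t" "ereal t < exit_time_plus UNIV (ball x r) \<xi>"
    using t by (metis abs_less_iff ereal_less(2) less_ereal.simps(1) le_less_trans minus_less_iff, metis abs_less_iff less_ereal.simps(1) less_le_trans)
qed

text \<open>If u stayed above the cone \<open>u x - k * dist x y\<close>, a steeper rounded cone of
  slope \<open>k1\<close> would touch it from below, up to \<open>\<delta> = k2 - k1\<close>. The
  test then gives \<open>f z \<le> k2\<close>, whereas \<open>k2 < f\<close> near x.\<close>

lemma s_supersolution_imp_le_slope_minus: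
  fixes u :: "'a::complete_space \<Rightarrow> real"
  assumes ls: "length_space TYPE('a)" and op: "open \<Omega>" and f: "continuous_on \<Omega> f"
    and u: "continuous_on \<Omega> u" and s: "s_supersolution \<Omega> f u" and x: "x \<in> \<Omega>"
  shows "ereal (f x) \<le> slope_minus u x"
proof (rule slope_minus_geI)
  fix k e :: real assume k: "0 \<le> k" "k < f x" and e: "0 < e"
  define k1 k2 where "k1 = k + (f x - k) / 3" and "k2 = k + (f x - k) * 2 / 3"
  have kk: "k < k1" "k1 < k2" "k2 < f x" using k by (auto simp: k1_def k2_def field_simps)
  have "continuous_on \<Omega> (\<lambda>x. - f x)" by (intro continuous_intros f)
  then obtain R1 where R1: "R1 > 0" "cball x R1 \<subseteq> \<Omega>" "\<And>y. y \<in> cball x R1 \<Longrightarrow> k2 < f y"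
    using continuous_on_cball_bound[OF op _ x, of "\<lambda>x. - f x" "- k2"] kk(3)
    by (metis neg_less_iff_less)
  have "continuous_on \<Omega> (\<lambda>x. - u x)" by (intro continuous_intros u)
  then obtain R2 where R2: "R2 > 0" "\<And>y. y \<in> cball x R2 \<Longrightarrow> - u y < - u x + 1"
    using continuous_on_cball_bound[OF op _ x, of "\<lambda>x. - u x" "- u x + 1"] by (metis less_add_one)
  define R where "R = min (min R1 R2) (e / 2)"
  have R: "0 < R" "R < e" using R1 R2 e by (auto simp: R_def)
  have sub: "cball x R \<subseteq> cball x R1" "cball x R \<subseteq> cball x R2" by (auto simp: R_def)
  show "\<exists>y. dist x y < e \<and> k * dist x y < u x - u y"
  proof (rule ccontr)
    assume none: "\<not> ?thesis"
    have less: "u x - k * dist x y \<le> u y" if "dist x y < e" for y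
    proof -
      have "\<not> k * dist x y < u x - u y" using none that by blast
      then show ?thesis by linarith
    qed
    \<comment> \<open>Rounding spends half of the margin \<open>(k1 - k) * R\<close>; the other half
      keeps the minimum off the sphere of radius R, without a quadratic term.\<close>
    define \<eta> where "\<eta> = (k1 - k) * R / (2 * k1)"
    have pos: "0 < k1" "0 < \<eta>" "(0::real) \<le> 0" using kk k R by (auto simp: \<eta>_def)
    have \<eta>: "k1 * \<eta> = (k1 - k) * R / 2" using pos by (simp add: \<eta>_def)
    let ?p = "smooth_cone k1 \<eta> 0"
    define \<delta> where "\<delta> = k2 - k1"
    have \<delta>: "0 < \<delta>" using kk by (simp add: \<delta>_def)
    define F where "F v = u v + ?p (dist x v)" for v
    have p_cont: "continuous_on UNIV ?p"
      by (rule continuous_on_smooth_cone[OF pos])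
    have F_cont: "continuous_on (cball x R) F"
      unfolding F_def using sub R1
      by (intro continuous_intros continuous_on_compose2[OF p_cont] continuous_on_subset[OF u]) auto
    have bdd: "u x - 1 \<le> F v" if "v \<in> cball x R" for v
    proof -
      have "u x - 1 \<le> u v" using R2(2)[of v] that sub by fastforce
      moreover have "0 \<le> ?p (dist x v)" using cone_ge_quadratic[OF pos, of "dist x v"] by simp
      ultimately show ?thesis by (simp add: F_def)
    qed
    obtain z where z: "z \<in> cball x R" "F z + \<delta> * dist x z \<le> F x"
      and min: "\<And>v. v \<in> cball x R \<Longrightarrow> F z \<le> F v + \<delta> * dist z v"
      using ekeland[OF closed_cball F_cont bdd _ \<delta>, of x] R by auto
    have "F x = u x" using cone_0[OF pos] by (simp add: F_def)
    moreover have "0 \<le> \<delta> * dist x z" using \<delta> by simp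
    ultimately have Fz: "F z \<le> u x" using z(2) by linarith
    have zR: "dist x z < R"
    proof (rule ccontr)
      assume "\<not> dist x z < R"
      then have d: "dist x z = R" using z(1) by simp
      have "k1 * R - k1 * \<eta> \<le> ?p R"
        using cone_ge_linear[OF pos, of R] R by (simp add: right_diff_distrib)
      moreover have "u x - k * R \<le> u z" using less[of z] d R by simp
      moreover have "F z = u z + ?p R" by (simp add: F_def d)
      ultimately have "k1 * R - k1 * \<eta> \<le> k * R" using Fz by linarith
      moreover have "k * R < k1 * R - k1 * \<eta>"
      proof -
        have "0 < (k1 - k) * R / 2" using kk R by simp
        then show ?thesis unfolding \<eta> by (simp add: field_simps)
      qed
      ultimately show False by simp
    qed
    let ?\<psi>1 = "\<lambda>v. - ?p (dist x v)" and ?\<psi>2 = "\<lambda>v. - (\<delta> * dist z v)"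
    note rad = radial_test_functions[OF ls op cone_has_derivative[OF pos] continuous_on_cone_deriv[OF pos]
        cone_deriv_0[OF pos] cone_deriv_nonneg[OF pos]]
    have sl: "slope ?\<psi>1 z = ereal (cone_deriv k1 \<eta> 0 (dist x z))"
      using rad(1) by (simp add: slope_uminus)
    have lip2: "\<delta>-lipschitz_on X ?\<psi>2" for X
      using \<delta> by (intro lipschitz_scaled_dist) simp
    have loc2: "locally_lipschitz_on \<Omega> ?\<psi>2"
      by (rule locally_lipschitz_onI[OF op]) (use lip2 zero_less_one in blast)
    have "local_min_at (\<lambda>v. u v - ?\<psi>1 v - ?\<psi>2 v) z"
      unfolding local_min_at_def
    proof -
      have "\<forall>\<^sub>F v in nhds z. v \<in> ball x R" using zR by (intro eventually_nhds_in_open) auto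
      then show "\<forall>\<^sub>F v in nhds z. u z - ?\<psi>1 z - ?\<psi>2 z \<le> u v - ?\<psi>1 v - ?\<psi>2 v"
        by eventually_elim (use min in \<open>simp add: F_def algebra_simps ball_def less_imp_le\<close>)
    qed
    moreover have "z \<in> \<Omega>" using z(1) sub R1(2) by auto
    ultimately have "ereal (f z) - slope_star ?\<psi>2 z \<le> slope ?\<psi>1 z"
      using s rad(3) loc2 unfolding s_supersolution_def by blast
    moreover have "ereal (f z) - ereal \<delta> \<le> ereal (f z) - slope_star ?\<psi>2 z"
      by (intro ereal_minus_mono order_refl slope_star_le_lipschitz lip2)
    ultimately have "ereal (f z - \<delta>) \<le> ereal (cone_deriv k1 \<eta> 0 (dist x z))"
      using sl by (metis ereal_minus(1) order_trans)
    \<comment> \<open>Only an upper bound on the slope of the cone enters, so \<open>z = x\<close>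
      is harmless.\<close>
    then have "f z - \<delta> \<le> k1" using cone_deriv_linear_le[OF pos(1,2), of "dist x z"] by simp
    moreover have "k2 < f z" using R1(3) sub z(1) by blast
    ultimately show False by (simp add: \<delta>_def)
  qed
qed

text \<open>The one-dimensional analogue along the given curve: if w were above
  \<open>u x - k1 * s\<close> at both times \<open>s\<close> and \<open>- s\<close>, a rounded cone
  of slope \<open>k2\<close> would touch w in between, against the test. So w drops at one of the
  two ends, and u drops there up to \<open>\<epsilon>\<close>.\<close>

lemma c_supersolution_imp_le_slope_minus:
  fixes u :: "'a::metric_space \<Rightarrow> real"
  assumes op: "open \<Omega>" and f: "continuous_on \<Omega> f"
    and c: "local_c_supersolution \<Omega> f u" and x: "x \<in> \<Omega>"
  shows "ereal (f x) \<le> slope_minus u x"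
proof (rule slope_minus_geI)
  fix k e :: real assume k: "0 \<le> k" "k < f x" and e: "0 < e"
  define k1 k2 k3 where "k1 = k + (f x - k) / 4" and "k2 = k + (f x - k) * 2 / 4"
    and "k3 = k + (f x - k) * 3 / 4"
  have kk: "k < k1" "k1 < k2" "k2 < k3" "k3 < f x"
    using k by (auto simp: k1_def k2_def k3_def field_simps)
  have "continuous_on \<Omega> (\<lambda>x. - f x)" by (intro continuous_intros f)
  then obtain R1 where R1: "R1 > 0" "\<And>y. y \<in> cball x R1 \<Longrightarrow> k3 < f y"
    using continuous_on_cball_bound[OF op _ x, of "\<lambda>x. - f x" "- k3"] kk(4)
    by (metis neg_less_iff_less)
  obtain r where r: "r > 0"
    and sup: "\<And>\<epsilon>. \<epsilon> > 0 \<Longrightarrow> \<exists>\<xi>\<in>admissible_curves x UNIV UNIV. \<exists>w. super_test f u x r \<epsilon> \<xi> w"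
    using c x unfolding local_c_supersolution_iff by blast
  define s where "s = Min {R1, r / 2, e / 2}"
  have s: "0 < s" "s \<le> R1" "s < r" "s < e" using R1 r e by (auto simp: s_def min_def)
  \<comment> \<open>The first bound makes the test contradictory, the second turns the drop of w
    into one of u. The ball is fixed before \<open>\<epsilon>\<close>, so \<open>\<epsilon>\<close>
    may depend on s.\<close>
  define \<epsilon> where "\<epsilon> = min (k3 - k2) ((k1 - k) * s / 2)"
  have \<epsilon>: "0 < \<epsilon>" "\<epsilon> \<le> k3 - k2" "\<epsilon> \<le> (k1 - k) * s / 2" unfolding \<epsilon>_def using kk s by simp_all (simp add: min_def)
  obtain \<xi> w J where \<xi>: "1-lipschitz_on UNIV \<xi>" "\<xi> 0 = x"
    and J: "J = {t. exit_time_minus UNIV (ball x r) \<xi> < ereal t \<and> ereal t < exit_time_plus UNIV (ball x r) \<xi>}"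
    and w: "lsc_on J w" "w 0 = u x" "\<And>t. t \<in> J \<Longrightarrow> u (\<xi> t) - \<epsilon> \<le> w t"
    and test: "\<And>\<phi> t0. t0 \<in> J \<Longrightarrow> \<phi> C1_differentiable_on UNIV \<Longrightarrow> local_min_at (\<lambda>t. w t - \<phi> t) t0 \<Longrightarrow>
                 f (\<xi> t0) - \<epsilon> \<le> \<bar>deriv \<phi> t0\<bar>"
    using sup[OF \<epsilon>(1)] unfolding super_test_def Let_def admissible_curves_def by blast
  have IJ: "{-s..s} \<subseteq> J"
    using abs_less_imp_before_exit[OF \<xi>] s(3) unfolding J by (auto simp: abs_less_iff)
  have dist: "dist x (\<xi> t) \<le> \<bar>t\<bar>" for t
    using lipschitz_onD[OF \<xi>(1), of 0 t] \<xi>(2) by (simp add: dist_real_def)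
  have "\<exists>t\<in>{-s, s}. w t \<le> u x - k1 * s"
  proof (rule ccontr)
    assume "\<not> ?thesis"
    then have ends: "u x - k1 * s < w (- s)" "u x - k1 * s < w s" by auto
    \<comment> \<open>Makes \<open>k2 * (s - \<eta>) = k1 * s\<close>, so the rounded cone is at
      least \<open>k1 * s\<close> at both ends.\<close>
    define \<eta> where "\<eta> = (k2 - k1) * s / k2"
    have pos: "0 < k2" "0 < \<eta>" "(0::real) \<le> 0" using kk k s by (auto simp: \<eta>_def)
    let ?p = "smooth_cone k2 \<eta> 0"
    let ?\<phi> = "\<lambda>t. - ?p t"
    have \<phi>_deriv: "(?\<phi> has_real_derivative - cone_deriv k2 \<eta> 0 t) (at t)" for t
      by (intro DERIV_minus cone_has_derivative[OF pos])
    have p_cont: "continuous_on UNIV ?p"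
      by (rule continuous_on_smooth_cone[OF pos])
    have "lsc_on {-s..s} (\<lambda>t. w t + ?p t)"
      by (intro lsc_on_add_continuous lsc_on_subset[OF w(1) IJ] continuous_on_subset[OF p_cont]) auto
    moreover have "{-s..s} \<noteq> {}" using s(1) by simp
    ultimately obtain t0 where t0: "t0 \<in> {-s..s}"
      and min: "\<And>t. t \<in> {-s..s} \<Longrightarrow> w t0 + ?p t0 \<le> w t + ?p t"
      using lsc_on_attains_inf[OF compact_Icc] by blast
    have "w t0 + ?p t0 \<le> u x" using min[of 0] s(1) w(2) cone_0[OF pos] by simp
    moreover have "k1 * s \<le> ?p s" "k1 * s \<le> ?p (- s)"
    proof -
      have "k2 * \<eta> = (k2 - k1) * s" using pos(1) by (simp add: \<eta>_def)
      then have "k2 * (s - \<eta>) = k1 * s" by (simp add: algebra_simps)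
      then show "k1 * s \<le> ?p s" "k1 * s \<le> ?p (- s)"
        using cone_ge_linear[OF pos, of s] cone_ge_linear[OF pos, of "- s"] s(1) by auto
    qed
    ultimately have "t0 \<noteq> s" "t0 \<noteq> - s" using ends by auto
    then have "t0 \<in> {-s<..<s}" using t0 by auto
    then have "\<forall>\<^sub>F t in nhds t0. t \<in> {-s<..<s}" by (intro eventually_nhds_in_open) auto
    then have "local_min_at (\<lambda>t. w t - ?\<phi> t) t0"
      unfolding local_min_at_def by eventually_elim (use min in auto)
    moreover have "?\<phi> C1_differentiable_on UNIV"
      by (rule C1_differentiable_realI[OF \<phi>_deriv])
        (intro continuous_intros continuous_on_cone_deriv[OF pos])
    ultimately have "f (\<xi> t0) - \<epsilon> \<le> \<bar>deriv ?\<phi> t0\<bar>" using test t0 IJ by blast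
    also have "deriv ?\<phi> t0 = - cone_deriv k2 \<eta> 0 t0" by (rule DERIV_imp_deriv[OF \<phi>_deriv])
    also have "\<bar>- cone_deriv k2 \<eta> 0 t0\<bar> \<le> k2" using cone_deriv_linear_le[OF pos(1,2)] by simp
    finally have "f (\<xi> t0) - \<epsilon> \<le> k2" .
    moreover have "\<xi> t0 \<in> cball x R1" using dist[of t0] t0 s(2) by auto
    ultimately show False using R1(2)[of "\<xi> t0"] \<epsilon>(2) by simp
  qed
  then obtain t where "t \<in> {-s, s}" and wt: "w t \<le> u x - k1 * s" by blast
  then have t: "\<bar>t\<bar> = s" using s(1) by auto
  have "t \<in> J" using IJ t by (auto simp: abs_if split: if_splits)
  then have "u (\<xi> t) - \<epsilon> \<le> u x - k1 * s" using w(3)[of t] wt by linarith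
  moreover have "0 < (k1 - k) * s" using kk s by simp
  ultimately have "k * s < u x - u (\<xi> t)" using \<epsilon>(3) by (simp add: algebra_simps)
  moreover have "k * dist x (\<xi> t) \<le> k * s" using dist[of t] t k(1) by (intro mult_left_mono) auto
  ultimately show "\<exists>y. dist x y < e \<and> k * dist x y < u x - u y"
    using dist[of t] t s(4) by (intro exI[of _ "\<xi> t"]) auto
qed

subsection \<open>From slopes to solutions\<close>

text \<open>At the maximum, \<open>\<psi>1 x - \<psi>1 y\<close> is at most \<open>u x - u y\<close>
  plus the increment of \<open>\<psi>2\<close>, which bounds \<open>slope_minus\<close> of
  \<open>\<psi>1\<close>. Membership in \<open>C_lower\<close> is what upgrades this to
  \<open>slope\<close>.\<close>

lemma slope_minus_le_imp_s_subsolution: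
  assumes u: "continuous_on \<Omega> u" and f: "\<And>x. x \<in> \<Omega> \<Longrightarrow> 0 \<le> f x" and s: "\<And>x. x \<in> \<Omega> \<Longrightarrow> slope_minus u x \<le> ereal (f x)"
  shows "s_subsolution \<Omega> f u"
  unfolding s_subsolution_def
proof (intro conjI continuous_on_imp_usc_on[OF u] allI ballI impI)
  fix \<psi>1 \<psi>2 x
  assume x: "x \<in> \<Omega>" and \<psi>1: "\<psi>1 \<in> C_lower \<Omega>"
    and max: "local_max_at (\<lambda>y. u y - \<psi>1 y - \<psi>2 y) x"
  show "slope \<psi>1 x \<le> ereal (f x) + slope_star \<psi>2 x"
  proof (cases "slope \<psi>2 x")
    case (real b)
    have b: "0 \<le> b" using slope_nonneg(1)[of \<psi>2 x] real by simp
    have "slope_minus \<psi>1 x \<le> ereal (f x + b)"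
      unfolding slope_minus_le_iff[OF add_nonneg_nonneg[OF f[OF x] b]]
    proof (intro allI impI)
      fix k assume k: "f x + b < k"
      define e where "e = (k - (f x + b)) / 2"
      have e: "f x < f x + e" "b < b + e" "k = (f x + e) + (b + e)" using k by (auto simp: e_def field_simps)
      have "\<forall>\<^sub>F y in at x. u x - u y \<le> (f x + e) * dist x y"
        using s[OF x] e(1) slope_minus_le_iff[OF f[OF x]] by blast
      moreover have "\<forall>\<^sub>F y in at x. \<bar>\<psi>2 y - \<psi>2 x\<bar> \<le> (b + e) * dist x y"
        using real e(2) slope_le_iff[OF b, of \<psi>2 x] by simp
      moreover have "\<forall>\<^sub>F y in at x. u y - \<psi>1 y - \<psi>2 y \<le> u x - \<psi>1 x - \<psi>2 x"
        using max unfolding local_max_at_def eventually_at_filter by eventually_elim simp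
      ultimately show "\<forall>\<^sub>F y in at x. \<psi>1 x - \<psi>1 y \<le> k * dist x y"
        by eventually_elim (simp add: e(3) distrib_right)
    qed
    moreover have "slope_minus \<psi>1 x = slope \<psi>1 x" using \<psi>1 x by (simp add: C_lower_def)
    moreover have "ereal (f x) + slope \<psi>2 x \<le> ereal (f x) + slope_star \<psi>2 x"
      by (intro add_left_mono slope_le_slope_star)
    ultimately show ?thesis using real by (metis order_trans plus_ereal.simps(1))
  next
    case PInf
    then have "slope_star \<psi>2 x = \<infinity>" using slope_le_slope_star[of \<psi>2 x] by simp
    then show ?thesis by simp
  next
    case MInf
    then show ?thesis using slope_nonneg(1)[of \<psi>2 x] by simp
  qed
qed

text \<open>At the minimum, the descent of u is at most the sum of the increments of the two test
  functions, so \<open>f x \<le> slope_minus u x\<close> is bounded by the sum of their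
  slopes.\<close>

lemma le_slope_minus_imp_s_supersolution:
  assumes u: "continuous_on \<Omega> u" and s: "\<And>x. x \<in> \<Omega> \<Longrightarrow> ereal (f x) \<le> slope_minus u x"
  shows "s_supersolution \<Omega> f u"
  unfolding s_supersolution_def
proof (intro conjI continuous_on_imp_lsc_on[OF u] allI ballI impI)
  fix \<psi>1 \<psi>2 x
  assume x: "x \<in> \<Omega>" and min: "local_min_at (\<lambda>y. u y - \<psi>1 y - \<psi>2 y) x"
  show "ereal (f x) - slope_star \<psi>2 x \<le> slope \<psi>1 x"
  proof (cases "slope \<psi>1 x"; cases "slope \<psi>2 x")
    fix a b assume ab: "slope \<psi>1 x = ereal a" "slope \<psi>2 x = ereal b"
    have a: "0 \<le> a" and b: "0 \<le> b" using slope_nonneg(1)[of \<psi>1 x] slope_nonneg(1)[of \<psi>2 x] ab by auto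
    have "slope_minus u x \<le> ereal (a + b)"
      unfolding slope_minus_le_iff[OF add_nonneg_nonneg[OF a b]]
    proof (intro allI impI)
      fix k assume k: "a + b < k"
      define e where "e = (k - (a + b)) / 2"
      have e: "a < a + e" "b < b + e" "k = (a + e) + (b + e)" using k by (auto simp: e_def field_simps)
      have "\<forall>\<^sub>F y in at x. \<bar>\<psi>1 y - \<psi>1 x\<bar> \<le> (a + e) * dist x y"
        using ab e(1) slope_le_iff[OF a, of \<psi>1 x] by simp
      moreover have "\<forall>\<^sub>F y in at x. \<bar>\<psi>2 y - \<psi>2 x\<bar> \<le> (b + e) * dist x y"
        using ab e(2) slope_le_iff[OF b, of \<psi>2 x] by simp
      moreover have "\<forall>\<^sub>F y in at x. u x - \<psi>1 x - \<psi>2 x \<le> u y - \<psi>1 y - \<psi>2 y"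
        using min unfolding local_min_at_def eventually_at_filter by eventually_elim simp
      ultimately show "\<forall>\<^sub>F y in at x. u x - u y \<le> k * dist x y"
        by eventually_elim (simp add: e(3) distrib_right)
    qed
    then have "ereal (f x) \<le> ereal (a + b)" using s[OF x] by (rule order_trans[rotated])
    then have "ereal (f x) - ereal b \<le> ereal a" by simp
    moreover have "ereal (f x) - slope_star \<psi>2 x \<le> ereal (f x) - ereal b"
      using slope_le_slope_star[of \<psi>2 x] ab by (intro ereal_minus_mono) auto
    ultimately show ?thesis unfolding ab(1) by (metis order_trans ereal_minus(1))
  next
    assume "slope \<psi>2 x = \<infinity>"
    then have "slope_star \<psi>2 x = \<infinity>" using slope_le_slope_star[of \<psi>2 x] by simp
    then show ?thesis by simp
  qed (use slope_nonneg[of \<psi>1 x] slope_nonneg[of \<psi>2 x] in auto)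
qed

text \<open>Touching from above gives \<open>\<phi> t - \<phi> 0 \<ge> - k * \<bar>t\<bar>\<close>
  for each \<open>k > f x\<close>. Read on both sides of 0, this one-sided bound controls the
  derivative in absolute value.\<close>

lemma slope_minus_le_imp_c_subsolution:
  assumes u: "continuous_on \<Omega> u" and f: "\<And>x. x \<in> \<Omega> \<Longrightarrow> 0 \<le> f x" and s: "\<And>x. x \<in> \<Omega> \<Longrightarrow> slope_minus u x \<le> ereal (f x)"
  shows "c_subsolution \<Omega> f u"
  unfolding c_subsolution_def
proof (intro conjI continuous_on_imp_usc_on[OF u] allI ballI impI)
  fix x \<xi> and \<phi> :: "real \<Rightarrow> real"
  assume x: "x \<in> \<Omega>" and \<xi>: "\<xi> \<in> admissible_curves x UNIV \<Omega>" and \<phi>: "\<phi> C1_differentiable_on UNIV"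
    and max: "local_max_at (\<lambda>t. u (\<xi> t) - \<phi> t) 0"
  have \<xi>': "1-lipschitz_on UNIV \<xi>" "\<xi> 0 = x" using \<xi> by (auto simp: admissible_curves_def)
  have lim: "filterlim \<xi> (nhds x) (nhds 0)"
    using lipschitz_on_continuous_on[OF \<xi>'(1)] \<xi>'(2)
    by (metis UNIV_I continuous_on_eq_continuous_at isCont_def open_UNIV tendsto_at_iff_tendsto_nhds)
  show "\<bar>deriv \<phi> 0\<bar> \<le> f x"
  proof (rule field_le_epsilon)
    fix e :: real assume e: "0 < e"
    let ?k = "f x + e"
    have k: "f x < ?k" "0 \<le> ?k" using e f[OF x] by auto
    have "\<forall>\<^sub>F y in at x. u x - u y \<le> ?k * dist x y"
      using s[OF x] k(1) slope_minus_le_iff[OF f[OF x]] by blast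
    then have "\<forall>\<^sub>F y in nhds x. u x - u y \<le> ?k * dist x y"
      unfolding eventually_at_filter by eventually_elim auto
    then have "\<forall>\<^sub>F t in nhds 0. u x - u (\<xi> t) \<le> ?k * dist x (\<xi> t)"
      by (rule eventually_compose_filterlim[OF _ lim])
    then have ev: "\<forall>\<^sub>F t in nhds 0. - ?k * \<bar>t\<bar> \<le> \<phi> t - \<phi> 0"
      using max unfolding local_max_at_def
    proof eventually_elim
      case (elim t)
      have "dist x (\<xi> t) \<le> \<bar>t\<bar>"
        using lipschitz_onD[OF \<xi>'(1), of 0 t] \<xi>'(2) by (simp add: dist_real_def)
      then have "?k * dist x (\<xi> t) \<le> ?k * \<bar>t\<bar>" using k(2) by (intro mult_left_mono)
      then show ?case using elim unfolding \<xi>'(2) mult_minus_left by linarith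
    qed
    have "- ?k \<le> deriv \<phi> 0"
      by (rule derivative_ge_right[OF C1_imp_deriv[OF \<phi>]])
        (use ev in \<open>auto simp: eventually_at_filter elim!: eventually_mono\<close>)
    moreover have "- ?k \<le> - deriv \<phi> 0"
    proof (rule derivative_ge_right)
      show "((\<lambda>s. \<phi> (- s)) has_real_derivative - deriv \<phi> 0) (at 0)"
        using derivative_reflect[OF C1_imp_deriv[OF \<phi>], of 0] by simp
      have "filterlim uminus (nhds (0::real)) (nhds 0)"
        using tendsto_minus[OF filterlim_ident, of "0::real"] by simp
      from eventually_compose_filterlim[OF ev this]
      show "\<forall>\<^sub>F t in at_right 0. - ?k * (t - 0) \<le> \<phi> (- t) - \<phi> (- 0)"
        by (auto simp: eventually_at_filter elim!: eventually_mono)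
    qed
    ultimately show "\<bar>deriv \<phi> 0\<bar> \<le> ?k" by simp
  qed
qed


subsection \<open>Descent curves\<close>

text \<open>An Ekeland point with constant \<open>c1 < c + \<delta>\<close> cannot be interior, as
  its \<open>slope_minus\<close> would be at most \<open>c1\<close>. It lies on the sphere of radius
  \<open>h' = c * h / c1\<close>, where the drop is at least \<open>c1 * h' = c * h\<close>. Since
  \<open>h' < h\<close>, an almost-geodesic can reach it within time h.\<close>

lemma descent_step:
  fixes u :: "'a::complete_space \<Rightarrow> real"
  assumes u: "continuous_on (cball y h) u" "\<And>z. z \<in> cball y h \<Longrightarrow> b \<le> u z"
    and h: "0 < h" and \<delta>: "0 < \<delta>"
    and s: "\<And>z. z \<in> ball y h \<Longrightarrow> ereal (c + \<delta>) \<le> slope_minus u z"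
  shows "\<exists>z. dist y z < h \<and> u z \<le> u y - c * h"
proof (cases "c \<le> 0")
  case True
  then have "c * h \<le> 0" using h by (simp add: mult_nonpos_nonneg)
  then show ?thesis using h by (intro exI[of _ y]) simp
next
  case False
  define c1 where "c1 = c + \<delta> / 2"
  have c1: "0 < c1" "c < c1" "c1 < c + \<delta>" using False \<delta> by (auto simp: c1_def)
  define h' where "h' = c * h / c1"
  have h': "0 < h'" "h' < h" "c1 * h' = c * h"
    using c1 False h by (auto simp: h'_def pos_divide_less_eq)
  have sub: "cball y h' \<subseteq> cball y h" using h' by auto
  obtain z where z: "z \<in> cball y h'" "u z + c1 * dist y z \<le> u y"
    and min: "\<And>v. v \<in> cball y h' \<Longrightarrow> u z \<le> u v + c1 * dist z v"
    using ekeland[OF closed_cball continuous_on_subset[OF u(1) sub] u(2) _ c1(1), of y] sub h' by auto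
  have "dist y z = h'"
  proof (rule ccontr)
    assume "dist y z \<noteq> h'"
    then have zh: "dist y z < h'" using z(1) by simp
    have "\<forall>\<^sub>F v in at z. v \<in> ball y h'" using zh by (intro eventually_at_in_open') auto
    then have "\<forall>\<^sub>F v in at z. u z - u v \<le> c1 * dist z v"
      by eventually_elim (use min in \<open>simp add: algebra_simps less_imp_le\<close>)
    then have "slope_minus u z \<le> ereal c1" using c1 by (intro slope_minus_leI) auto
    moreover have "ereal (c + \<delta>) \<le> slope_minus u z" using s zh h' by simp
    ultimately have "ereal (c + \<delta>) \<le> ereal c1" by (rule order_trans[rotated])
    then show False using c1 by simp
  qed
  then show ?thesis using z(2) h' by (intro exI[of _ z]) auto
qed

text \<open>Used both for the curve and for the interpolated values. Composition with the absolute
  value extends forward data to the whole line.\<close>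

lemma lipschitz_glue_even:
  fixes G :: "nat \<Rightarrow> real \<Rightarrow> 'b::metric_space"
  assumes h: "0 < h" and G: "\<And>n. C-lipschitz_on {0..h} (G n)" "\<And>n. G n h = G (Suc n) 0"
  obtains F where "C-lipschitz_on UNIV F" "\<And>t. F (- t) = F t" "\<And>n s. s \<in> {0..h} \<Longrightarrow> F (real n * h + s) = G n s"
proof -
  define k where "k t = nat \<lfloor>t / h\<rfloor>" for t :: real
  define F where "F t = G (k t) (t - real (k t) * h)" for t
  have k: "k (real n * h + s) = n" if "0 \<le> s" "s < h" for n s
  proof -
    have "(real n * h + s) / h = real n + s / h" using h by (simp add: add_divide_distrib)
    moreover have "\<lfloor>real n + s / h\<rfloor> = int n" using that h by (simp add: floor_eq_iff)
    ultimately show ?thesis by (simp add: k_def)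
  qed
  have F: "F (real n * h + s) = G n s" if "s \<in> {0..h}" for n s
  proof (cases "s = h")
    case True
    have "F (real (Suc n) * h + 0) = G (Suc n) 0" unfolding F_def using k[of 0 "Suc n"] h by simp
    moreover have "real (Suc n) * h + 0 = real n * h + s" using True by (simp add: algebra_simps)
    ultimately show ?thesis using G(2) True by simp
  next
    case False
    then show ?thesis using that k[of s n] by (simp add: F_def)
  qed
  have piece: "C-lipschitz_on {real n * h..real (Suc n) * h} F" for n
  proof (rule lipschitz_onI)
    show "0 \<le> C" by (rule lipschitz_on_nonneg[OF G(1)])
    fix s t assume st: "s \<in> {real n * h..real (Suc n) * h}" "t \<in> {real n * h..real (Suc n) * h}"
    define s' t' where "s' = s - real n * h" and "t' = t - real n * h"
    have "s' \<in> {0..h}" "t' \<in> {0..h}" using st by (auto simp: s'_def t'_def algebra_simps)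
    moreover have "F s = G n s'" "F t = G n t'"
      using F[of s' n] F[of t' n] calculation by (auto simp: s'_def t'_def)
    ultimately show "dist (F s) (F t) \<le> C * dist s t"
      using lipschitz_onD[OF G(1)[of n], of s' t'] by (simp add: s'_def t'_def dist_real_def)
  qed
  have lip: "C-lipschitz_on {0..real n * h} F" for n
  proof (induction n)
    case 0
    then show ?case by (simp add: lipschitz_on_nonneg[OF G(1)])
  next
    case (Suc n)
    then show ?case using lipschitz_on_concat[OF Suc piece[of n]] by simp
  qed
  have abs: "C-lipschitz_on UNIV (\<lambda>t. F \<bar>t\<bar>)"
  proof (rule lipschitz_onI)
    show C: "0 \<le> C" by (rule lipschitz_on_nonneg[OF G(1)])
    fix s t :: real
    obtain n :: nat where "max \<bar>s\<bar> \<bar>t\<bar> / h \<le> real n" using real_arch_simple by blast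
    then have "max \<bar>s\<bar> \<bar>t\<bar> \<le> real n * h" using h by (simp add: pos_divide_le_eq)
    then have "dist (F \<bar>s\<bar>) (F \<bar>t\<bar>) \<le> C * dist \<bar>s\<bar> \<bar>t\<bar>" by (intro lipschitz_onD[OF lip[of n]]) auto
    also have "\<dots> \<le> C * dist s t" using C by (intro mult_left_mono) (auto simp: dist_real_def)
    finally show "dist (F \<bar>s\<bar>) (F \<bar>t\<bar>) \<le> C * dist s t" .
  qed
  show ?thesis
  proof (rule that[OF abs])
    fix n s assume s: "s \<in> {0..h}"
    then have "\<bar>real n * h + s\<bar> = real n * h + s" using h by simp
    then show "F \<bar>real n * h + s\<bar> = G n s" using F[OF s] by simp
  qed simp
qed

text \<open>Evenness makes the exit times symmetric, so being before exit at t places the whole time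
  interval up to \<open>\<bar>t\<bar>\<close> in U.\<close>

lemma even_curve_before_exit:
  assumes even: "\<And>t. \<xi> (- t) = \<xi> t"
    and t: "exit_time_minus UNIV U \<xi> < ereal t" "ereal t < exit_time_plus UNIV U \<xi>" and s: "\<bar>s\<bar> \<le> \<bar>t\<bar>"
  shows "\<xi> s \<in> U"
proof (rule ccontr)
  assume "\<xi> s \<notin> U"
  then have "\<xi> \<bar>s\<bar> \<notin> U" "\<xi> (- \<bar>s\<bar>) \<notin> U" using even[of s] even[of "\<bar>s\<bar>"] by (auto simp: abs_if)
  then have "exit_time_plus UNIV U \<xi> \<le> ereal \<bar>s\<bar>" "ereal (- \<bar>s\<bar>) \<le> exit_time_minus UNIV U \<xi>"
    unfolding exit_time_plus_def exit_time_minus_def by (intro Inf_lower Sup_upper imageI; simp)+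
  then have "ereal t < ereal \<bar>s\<bar>" "ereal (- \<bar>s\<bar>) < ereal t" using less_le_trans[OF t(2)] le_less_trans[OF _ t(1)] by blast+
  then show False using s by simp
qed

text \<open>
  Following almost-steepest descent in steps of length \<open>h\<close>, the interpolation \<open>w\<close> of \<open>u\<close> at the nodes
  has slope at most \<open>- f + \<epsilon>\<close> on each step, and only right derivatives of \<open>w\<close> are needed for the test.
  Traversing the same curve backwards covers negative times.
\<close>

lemma le_slope_minus_imp_c_supersolution:
  fixes u :: "'a::complete_space \<Rightarrow> real"
  assumes ls: "length_space TYPE('a)" and f: "locally_uniformly_continuous_on \<Omega> f"
    and u: "continuous_on \<Omega> u" "locally_lipschitz_on \<Omega> u"
    and sl: "\<And>x. x \<in> \<Omega> \<Longrightarrow> ereal (f x) \<le> slope_minus u x"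
  shows "local_c_supersolution \<Omega> f u"
  unfolding local_c_supersolution_iff
proof (intro conjI continuous_on_imp_lsc_on[OF u(1)] ballI)
  fix x assume x: "x \<in> \<Omega>"
  obtain rf where rf: "rf > 0" "ball x rf \<subseteq> \<Omega>" "uniformly_continuous_on (ball x rf) f"
    using f x unfolding locally_uniformly_continuous_on_def by blast
  obtain ru M where ru: "ru > 0" "M-lipschitz_on (ball x ru) u"
    using u(2) x unfolding locally_lipschitz_on_def by blast
  \<comment> \<open>Nodes overshoot \<open>ball x r\<close> by less than one step, and steps are at
    most r, so all estimates take place in \<open>ball x (3 * r)\<close>.\<close>
  define r where "r = min rf ru / 3"
  have r: "0 < r" using rf ru by (simp add: r_def)
  have sub: "ball x (3 * r) \<subseteq> ball x rf" "ball x (3 * r) \<subseteq> ball x ru"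
    by (auto simp: r_def)
  have M: "0 \<le> M" by (rule lipschitz_on_nonneg[OF ru(2)])
  have uM: "\<bar>u y - u z\<bar> \<le> M * dist y z" if "y \<in> ball x (3 * r)" "z \<in> ball x (3 * r)" for y z
    using lipschitz_onD[OF ru(2) subsetD[OF sub(2) that(1)] subsetD[OF sub(2) that(2)]]
    by (simp add: dist_real_def)
  have main: "\<exists>\<xi>\<in>admissible_curves x UNIV UNIV. \<exists>w. super_test f u x r \<epsilon> \<xi> w" if \<epsilon>: "0 < \<epsilon>" for \<epsilon> :: real
  proof -
    \<comment> \<open>Of the three parts, one covers the variation of f on the step ball, one the
      margin required by \<open>descent_step\<close>, and one the passage from the node to the
      tested point.\<close>
    define e where "e = \<epsilon> / 3"
    have e: "0 < e" using \<epsilon> by (simp add: e_def)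
    obtain d where d: "0 < d"
      and fd: "\<And>y z. y \<in> ball x rf \<Longrightarrow> z \<in> ball x rf \<Longrightarrow> dist y z < d \<Longrightarrow> dist (f y) (f z) < e"
      using rf(3) e unfolding uniformly_continuous_on_def by metis
    \<comment> \<open>The error \<open>M * h\<close> occurs twice, for u between node and curve and
      for the affine interpolation. The summand 1 keeps the denominator positive if
      \<open>M = 0\<close>.\<close>
    define h where "h = Min {r, d, \<epsilon> / (2 * M + 1)}"
    have h: "0 < h" "h \<le> r" "h \<le> d" using r d \<epsilon> M by (auto simp: h_def)
    have "h \<le> \<epsilon> / (2 * M + 1)" by (simp add: h_def)
    then have "h * (2 * M + 1) \<le> \<epsilon>" using M by (simp add: pos_le_divide_eq)
    then have Mh: "2 * (M * h) \<le> \<epsilon>" using h by (simp add: algebra_simps)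
    have fh: "\<bar>f y - f z\<bar> < e" if "y \<in> ball x (3 * r)" "z \<in> ball x (3 * r)" "dist y z < h" for y z
      using fd[OF subsetD[OF sub(1) that(1)] subsetD[OF sub(1) that(2)]] that(3) h
      by (simp add: dist_real_def)
    \<comment> \<open>Outside \<open>ball x r\<close> the step is stationary, so it can be iterated
      without conditions and the nodes stay near x.\<close>
    have "\<exists>z. dist y z < h \<and> (if y \<in> ball x r then u z \<le> u y - (f y - 2 * e) * h else z = y)" for y
    proof (cases "y \<in> ball x r")
      case True
      have in3: "cball y h \<subseteq> ball x (3 * r)"
      proof
        fix z assume "z \<in> cball y h"
        then show "z \<in> ball x (3 * r)" using True h dist_triangle[of x z y] by simp
      qed
      have y3: "y \<in> ball x (3 * r)" using True r by simp
      have "\<exists>z. dist y z < h \<and> u z \<le> u y - (f y - 2 * e) * h"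
      proof (rule descent_step[OF _ _ h(1) e])
        show "continuous_on (cball y h) u"
          using in3 sub(1) rf(2) by (intro continuous_on_subset[OF u(1)]) blast
        show "u y - M * h \<le> u z" if "z \<in> cball y h" for z
        proof -
          have "M * dist y z \<le> M * h" using that M by (intro mult_left_mono) auto
          then show ?thesis using uM[of y z] in3 that y3 by (auto simp: abs_le_iff)
        qed
        show "ereal (f y - 2 * e + e) \<le> slope_minus u z" if z: "z \<in> ball y h" for z
        proof -
          have z3: "z \<in> ball x (3 * r)" using z by (intro subsetD[OF in3]) simp
          have "f y - 2 * e + e \<le> f z" using fh[OF y3 z3] z by simp
          then have "ereal (f y - 2 * e + e) \<le> ereal (f z)" by simp
          also have "\<dots> \<le> slope_minus u z" using z3 sub(1) rf(2) by (intro sl) blast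
          finally show ?thesis .
        qed
      qed
      then show ?thesis using True by simp
    qed (use h in auto)
    then obtain S where S':
        "\<And>y. dist y (S y) < h \<and> (if y \<in> ball x r then u (S y) \<le> u y - (f y - 2 * e) * h else S y = y)"
      by metis
    have S: "dist y (S y) < h" "y \<in> ball x r \<Longrightarrow> u (S y) \<le> u y - (f y - 2 * e) * h"
        "y \<notin> ball x r \<Longrightarrow> S y = y" for y
      using S'[of y] by presburger+
    define X where "X n = (S ^^ n) x" for n
    have X: "X 0 = x" "X (Suc n) = S (X n)" for n by (auto simp: X_def)
    have X3: "X n \<in> ball x (3 * r)" for n
    proof -
      have "dist x (X n) < 2 * r"
      proof (induction n)
        case (Suc n)
        show ?case
        proof (cases "X n \<in> ball x r")
          case True
          then show ?thesis using S(1)[of "X n"] h dist_triangle[of x "X (Suc n)" "X n"] by (simp add: X)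
        qed (use Suc S(3) X in simp)
      qed (use r X in simp)
      then show ?thesis using r by simp
    qed
    have "\<exists>\<gamma>. 1-lipschitz_on UNIV \<gamma> \<and> \<gamma> 0 = X n \<and> \<gamma> h = X (Suc n)" for n
    proof -
      have "dist (X n) (X (Suc n)) < h" using S(1) X(2) by simp
      from length_space_curve[OF ls this] show ?thesis by (metis order_refl)
    qed
    then obtain G where G: "\<And>n. 1-lipschitz_on UNIV (G n)" "\<And>n. G n 0 = X n" "\<And>n. G n h = X (Suc n)"
      by metis
    define a where "a n = (u (X (Suc n)) - u (X n)) / h" for n
    have a_le: "\<bar>a n\<bar> \<le> M" for n
    proof -
      have "\<bar>u (X (Suc n)) - u (X n)\<bar> \<le> M * dist (X (Suc n)) (X n)" by (rule uM[OF X3 X3])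
      also have "\<dots> \<le> M * h"
        using S(1)[of "X n"] M X(2)[of n] by (intro mult_left_mono) (auto simp: dist_commute)
      finally show ?thesis using h by (simp add: a_def abs_divide pos_divide_le_eq)
    qed
    have a_descent: "a n \<le> - (f (X n) - 2 * e)" if "X n \<in> ball x r" for n
    proof -
      have "u (X (Suc n)) - u (X n) \<le> - (f (X n) - 2 * e) * h"
        using S(2)[OF that] unfolding X(2) mult_minus_left by linarith
      then show ?thesis using h unfolding a_def by (simp only: pos_divide_le_eq)
    qed
    have lipW: "M-lipschitz_on {0..h} (\<lambda>s. u (X n) + a n * s)" for n
    proof (rule lipschitz_onI[OF _ M])
      fix s t :: real
      have "\<bar>a n\<bar> * \<bar>s - t\<bar> \<le> M * \<bar>s - t\<bar>" by (intro mult_right_mono a_le) auto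
      then show "dist (u (X n) + a n * s) (u (X n) + a n * t) \<le> M * dist s t"
        by (simp add: dist_real_def abs_mult flip: right_diff_distrib)
    qed
    have G1: "1-lipschitz_on {0..h} (G n)" for n by (rule lipschitz_on_subset[OF G(1)]) auto
    have Gh: "G n h = G (Suc n) 0" for n by (simp add: G)
    have Wh: "u (X n) + a n * h = u (X (Suc n)) + a (Suc n) * 0" for n using h by (simp add: a_def)
    obtain \<xi> where \<xi>: "1-lipschitz_on UNIV \<xi>" "\<And>t. \<xi> (- t) = \<xi> t"
        "\<And>n s. s \<in> {0..h} \<Longrightarrow> \<xi> (real n * h + s) = G n s"
      using lipschitz_glue_even[where G=G, OF h(1) G1 Gh] by blast
    obtain w where w: "M-lipschitz_on UNIV w" "\<And>t. w (- t) = w t"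
        "\<And>n s. s \<in> {0..h} \<Longrightarrow> w (real n * h + s) = u (X n) + a n * s"
      using lipschitz_glue_even[where G="\<lambda>n s. u (X n) + a n * s", OF h(1) lipW Wh] by blast
    have \<xi>0: "\<xi> 0 = x" using \<xi>(3)[of 0 0] G(2) X(1) h by simp
    have w0: "w 0 = u x" using w(3)[of 0 0] X(1) h by simp
    have cell: "\<exists>n s. 0 \<le> s \<and> s < h \<and> t = real n * h + s" if "0 \<le> t" for t
    proof -
      define n where "n = nat \<lfloor>t / h\<rfloor>"
      have "real n \<le> t / h" "t / h < real n + 1" using that h unfolding n_def by (auto simp: floor_le_iff)
      then have "real n * h \<le> t" "t < (real n + 1) * h" using h by (auto simp: pos_le_divide_eq pos_divide_less_eq)
      then show ?thesis by (intro exI[of _ n] exI[of _ "t - real n * h"]) (auto simp: algebra_simps)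
    qed
    have node: "X n \<in> ball x r" if "\<And>s. \<bar>s\<bar> \<le> real n * h + \<sigma> \<Longrightarrow> \<xi> s \<in> ball x r" "0 \<le> \<sigma>" for n \<sigma>
      using that(1)[of "real n * h"] that(2) \<xi>(3)[of 0 n] G(2)[of n] h by simp
    have close: "dist (X n) (\<xi> (real n * h + \<sigma>)) \<le> \<sigma>" if "0 \<le> \<sigma>" "\<sigma> < h" for n \<sigma>
      using lipschitz_onD[OF G(1)[of n], of 0 \<sigma>] \<xi>(3)[of \<sigma> n] G(2)[of n] that by (simp add: dist_real_def)
    have above: "u (\<xi> t) - \<epsilon> \<le> w t" if t: "0 \<le> t" and inside: "\<And>s. \<bar>s\<bar> \<le> t \<Longrightarrow> \<xi> s \<in> ball x r" for t
    proof -
      obtain n \<sigma> where \<sigma>: "0 \<le> \<sigma>" "\<sigma> < h" and t_eq: "t = real n * h + \<sigma>" using cell[OF t] by blast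
      have "\<xi> t \<in> ball x (3 * r)" using inside[of t] t r by simp
      then have "\<bar>u (X n) - u (\<xi> t)\<bar> \<le> M * dist (X n) (\<xi> t)" by (rule uM[OF X3])
      also have "\<dots> \<le> M * h" using close[OF \<sigma>, of n] \<sigma> M by (intro mult_left_mono) (auto simp: t_eq)
      finally have "u (\<xi> t) \<le> u (X n) + M * h" by simp
      moreover have "\<bar>a n * \<sigma>\<bar> \<le> M * h"
        unfolding abs_mult using a_le[of n] \<sigma> M by (intro mult_mono) auto
      moreover have "w t = u (X n) + a n * \<sigma>" using w(3)[of \<sigma> n] \<sigma> by (simp add: t_eq)
      ultimately show ?thesis using Mh by linarith
    qed
    have test: "f (\<xi> t) - \<epsilon> \<le> - D"
      if t: "0 \<le> t" and inside: "\<And>s. \<bar>s\<bar> \<le> t \<Longrightarrow> \<xi> s \<in> ball x r"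
        and \<psi>: "(\<psi> has_real_derivative D) (at t)" and min: "local_min_at (\<lambda>s. w s - \<psi> s) t" for t \<psi> D
    proof -
      obtain n \<sigma> where \<sigma>: "0 \<le> \<sigma>" "\<sigma> < h" and t_eq: "t = real n * h + \<sigma>" using cell[OF t] by blast
      have Xn: "X n \<in> ball x r" using node inside \<sigma>(1) unfolding t_eq by blast
      have wt: "w t = u (X n) + a n * \<sigma>" using w(3)[of \<sigma> n] \<sigma> by (simp add: t_eq)
      have "\<forall>\<^sub>F s in at_right t. s \<in> {t<..<t + (h - \<sigma>)}"
        using \<sigma> by (intro eventually_at_right_real) simp
      moreover have "\<forall>\<^sub>F s in at_right t. w t - \<psi> t \<le> w s - \<psi> s"
        using min unfolding local_min_at_def eventually_at_filter by eventually_elim simp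
      ultimately have "\<forall>\<^sub>F s in at_right t. - a n * (s - t) \<le> - \<psi> s - - \<psi> t"
      proof eventually_elim
        case (elim s)
        then have "s - real n * h \<in> {0..h}" using \<sigma> by (auto simp: t_eq)
        from w(3)[OF this, of n] have "w s = u (X n) + a n * (s - real n * h)" by simp
        then have "w s - w t = a n * (s - t)" using wt by (simp add: t_eq algebra_simps)
        then show ?case using elim(2) unfolding mult_minus_left by linarith
      qed
      \<comment> \<open>Touching w from below bounds the derivative of the test function by the
        slope \<open>a n\<close> of w to the right, so it is negative enough.\<close>
      then have "- a n \<le> - D" by (rule derivative_ge_right[OF DERIV_minus[OF \<psi>]])
      moreover have "\<xi> t \<in> ball x (3 * r)" using inside[of t] t r by simp
      then have "\<bar>f (X n) - f (\<xi> t)\<bar> < e"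
        using close[OF \<sigma>, of n] \<sigma> by (intro fh X3) (auto simp: t_eq)
      ultimately show ?thesis using a_descent[OF Xn] unfolding e_def by arith
    qed
    define J where "J = {t. exit_time_minus UNIV (ball x r) \<xi> < ereal t \<and> ereal t < exit_time_plus UNIV (ball x r) \<xi>}"
    have inside: "\<xi> s \<in> ball x r" if "t \<in> J" "\<bar>s\<bar> \<le> \<bar>t\<bar>" for s t
      using even_curve_before_exit[of \<xi> "ball x r" t s] \<xi>(2) that unfolding J_def by blast
    have abs: "w \<bar>t\<bar> = w t" "\<xi> \<bar>t\<bar> = \<xi> t" for t using w(2)[of t] \<xi>(2)[of t] by (auto simp: abs_if)
    have "\<xi> \<in> admissible_curves x UNIV UNIV" using \<xi>(1) \<xi>0 by (simp add: admissible_curves_def)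
    moreover have "lsc_on J w"
      by (intro continuous_on_imp_lsc_on continuous_on_subset[OF lipschitz_on_continuous_on[OF w(1)]]) simp
    moreover have "u (\<xi> t) - \<epsilon> \<le> w t" if "t \<in> J" for t
      using above[of "\<bar>t\<bar>"] inside[OF that] abs by auto
    moreover have "f (\<xi> t) - \<epsilon> \<le> \<bar>deriv \<phi> t\<bar>"
      if t: "t \<in> J" and \<phi>: "\<phi> C1_differentiable_on UNIV" and min: "local_min_at (\<lambda>t. w t - \<phi> t) t" for \<phi> t
    proof (cases "0 \<le> t")
      case True
      then show ?thesis using test[OF True _ C1_imp_deriv[OF \<phi>] min] inside[OF t] by force
    next
      case False
      \<comment> \<open>As w and \<open>\<xi>\<close> are even, a test at a negative time becomes
        one at \<open>- t\<close> for the reflected function, whose derivative has the same absolute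
        value.\<close>
      have "filterlim uminus (nhds t) (nhds (- t))"
        using tendsto_minus[OF filterlim_ident, of "- t"] by simp
      from eventually_compose_filterlim[OF min[unfolded local_min_at_def] this]
      have "local_min_at (\<lambda>s. w s - \<phi> (- s)) (- t)" by (simp add: local_min_at_def w(2))
      with False derivative_reflect[OF C1_imp_deriv[OF \<phi>], of t]
      have "f (\<xi> (- t)) - \<epsilon> \<le> - (- deriv \<phi> t)" using inside[OF t] by (intro test) auto
      then show ?thesis using \<xi>(2) by simp
    qed
    ultimately show ?thesis
      using w0 by (intro bexI[of _ \<xi>] exI[of _ w]) (auto simp: super_test_def Let_def simp flip: J_def)
  qed
  have "ball x r \<subseteq> ball x (3 * r)" using r by (intro subset_ball) simp
  then have "ball x r \<subseteq> \<Omega>" using sub(1) rf(2) by blast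
  then show "\<exists>r>0. ball x r \<subseteq> \<Omega> \<and> (\<forall>\<epsilon>>0. \<exists>\<xi>\<in>admissible_curves x UNIV UNIV. \<exists>w. super_test f u x r \<epsilon> \<xi> w)"
    using main r by blast
qed

section \<open>Local regularity and the equivalence of the three notions\<close>

lemma locally_lipschitz_imp_locally_uniformly_continuous:
  assumes "locally_lipschitz_on \<Omega> u"
  shows "locally_uniformly_continuous_on \<Omega> u"
  using assms unfolding locally_lipschitz_on_def locally_uniformly_continuous_on_def
  by (meson lipschitz_on_uniformly_continuous)

lemma locally_uniformly_continuous_imp_continuous_on:
  assumes "locally_uniformly_continuous_on \<Omega> u"
  shows "continuous_on \<Omega> u"
proof (rule continuous_at_imp_continuous_on, intro ballI)
  fix x assume "x \<in> \<Omega>"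
  then obtain r where r: "r > 0" "uniformly_continuous_on (ball x r) u"
    using assms unfolding locally_uniformly_continuous_on_def by blast
  then have "continuous_on (ball x r) u" by (intro uniformly_continuous_imp_continuous)
  then show "isCont u x" using r(1) by (simp add: continuous_on_eq_continuous_at)
qed

theorem theorem1p2:
  fixes \<Omega> :: "'a::complete_space set" and f u :: "'a \<Rightarrow> real"
  assumes "length_space TYPE('a)"
    and "open \<Omega>"
    and "locally_uniformly_continuous_on \<Omega> f"
    and "\<forall>x\<in>\<Omega>. f x > 0"
    and "continuous_on \<Omega> u"
  shows "(local_c_solution \<Omega> f u \<longleftrightarrow>
            locally_uniformly_continuous_on \<Omega> u \<and> s_solution \<Omega> f u)
       \<and> (locally_uniformly_continuous_on \<Omega> u \<and> s_solution \<Omega> f u \<longleftrightarrow>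
            Monge_solution \<Omega> f u)
       \<and> (local_c_solution \<Omega> f u \<or>
          (locally_uniformly_continuous_on \<Omega> u \<and> s_solution \<Omega> f u) \<or>
          Monge_solution \<Omega> f u \<longrightarrow>
            locally_lipschitz_on \<Omega> u \<and>
            (\<forall>x\<in>\<Omega>. slope u x = slope_minus u x \<and> slope_minus u x = ereal (f x)))"
proof -
  note ls = assms(1) and op = assms(2) and u = assms(5)
  have f0: "0 \<le> f x" if "x \<in> \<Omega>" for x using assms(4) that by (simp add: less_imp_le)
  have f: "continuous_on \<Omega> f" by (rule locally_uniformly_continuous_imp_continuous_on[OF assms(3)])
  let ?super = "\<forall>x\<in>\<Omega>. ereal (f x) \<le> slope_minus u x"
  have core_c: "locally_dominated \<Omega> f u \<and> ?super" if "local_c_solution \<Omega> f u"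
    using that c_subsolution_imp_locally_dominated[OF ls op f f0 u]
      c_supersolution_imp_le_slope_minus[OF op f]
    unfolding local_c_solution_def by blast
  have core_s: "locally_dominated \<Omega> f u \<and> ?super" if "s_solution \<Omega> f u"
    using that s_subsolution_imp_locally_dominated[OF ls op f f0 u]
      s_supersolution_imp_le_slope_minus[OF ls op f u]
    unfolding s_solution_def by blast
  have core_Monge: "locally_dominated \<Omega> f u \<and> ?super" if "Monge_solution \<Omega> f u"
  proof -
    have "s_subsolution \<Omega> f u"
      using that by (intro slope_minus_le_imp_s_subsolution u f0) (auto simp: Monge_solution_def)
    then show ?thesis
      using that s_subsolution_imp_locally_dominated[OF ls op f f0 u] by (simp add: Monge_solution_def)
  qed
  have all: "locally_lipschitz_on \<Omega> u
      \<and> (\<forall>x\<in>\<Omega>. slope u x = slope_minus u x \<and> slope_minus u x = ereal (f x))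
      \<and> local_c_solution \<Omega> f u \<and> locally_uniformly_continuous_on \<Omega> u \<and> s_solution \<Omega> f u
      \<and> Monge_solution \<Omega> f u"
    if "locally_dominated \<Omega> f u \<and> ?super"
  proof -
    have lip: "locally_lipschitz_on \<Omega> u"
      using that by (intro locally_dominated_imp_locally_lipschitz[OF op]) blast
    have "slope u x = slope_minus u x" "slope_minus u x = ereal (f x)" if "x \<in> \<Omega>" for x
      using locally_dominated_imp_slope_le[of \<Omega> f u x] slope_minus_le_slope[of u x]
        \<open>locally_dominated \<Omega> f u \<and> ?super\<close> that by (meson order.antisym order.trans)+
    moreover have "local_c_solution \<Omega> f u"
      unfolding local_c_solution_def
      using u slope_minus_le_imp_c_subsolution[OF u f0]
        le_slope_minus_imp_c_supersolution[OF ls assms(3) u lip] calculation(2) by simp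
    moreover have "s_solution \<Omega> f u"
      unfolding s_solution_def
      using u slope_minus_le_imp_s_subsolution[OF u f0] le_slope_minus_imp_s_supersolution[OF u]
        calculation(2) by simp
    ultimately show ?thesis
      using lip locally_lipschitz_imp_locally_uniformly_continuous[OF lip]
      by (simp add: Monge_solution_def)
  qed
  show ?thesis using core_c core_s core_Monge all by blast
qed

end
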